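(* Let $n$ be a positive rational number and put $x = G_{25n}/G_n^5$. Then \[ \frac{\varphi(e^{-25\pi\sqrt{n}})}{\varphi(e^{-\pi\sqrt{n}})} = \frac{1}{5}\Big(1 +\Big\{x\Big[(2x - 1)^2 + 7 + (4 - 2x)(4 + 4x^2)^{1/2}\Big]\Big\}^{1/5} + \Big\{x\Big[(2x - 1)^2 + 7 - (4 - 2x)(4 + 4x^2)^{1/2}\Big]\Big\}^{1/5}\Big), \] where the fifth roots are real fifth roots.
   Context: $\varphi(q)=\sum_{n=-\infty}^{\infty}q^{n^2}$ for $|q|<1$. With $(a;q)_\infty=\prod_{k\ge0}(1-aq^k)$ and $\chi(q)=(-q;q^2)_\infty$, Ramanujan's class invariant is defined for positive rational $n$ by $G_n = 2^{-1/4}q^{-1/24}\chi(q)$ with $q=e^{-\pi\sqrt{n}}$. *)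

theory Defs
  imports "HOL-Analysis.Analysis"
begin

text \<open>
  All functions of \<open>q\<close> below are meant for \<open>norm q < 1\<close>, where the series and products
  converge, and \<open>class_invariant_G\<close> for positive arguments.
\<close>

definition ramanujan_phi :: "'a :: {real_normed_field, banach} \<Rightarrow> 'a" where
  "ramanujan_phi q = (\<Sum>\<^sub>\<infinity>n\<in>(UNIV :: int set). q powi (n ^ 2))"

definition qpochhammer_inf :: "'a :: {real_normed_field, banach} \<Rightarrow> 'a \<Rightarrow> 'a" where
  "qpochhammer_inf a q = (\<Prod>k. 1 - a * q ^ k)"

definition ramanujan_chi :: "'a :: {real_normed_field, banach} \<Rightarrow> 'a" where
  "ramanujan_chi q = qpochhammer_inf (- q) (q ^ 2)"

definition class_invariant_G :: "rat \<Rightarrow> real" where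
  "class_invariant_G n =
    (let q = exp (- pi * sqrt (of_rat n))
     in 2 powr (- 1 / 4) * q powr (- 1 / 24) * ramanujan_chi q)"

end

theory Submission
  imports Defs "HOL-Real_Asymp.Real_Asymp"
begin

text \<open>
  Put \<open>\<tau> = \<surd>n\<close>, \<open>p = exp (- \<pi> / (25 \<tau>))\<close> and \<open>P = p\<^sup>5\<close>. Theta inversion turns the quotient into
  \<open>\<phi>(p) / (5 \<phi>(p\<^sup>2\<^sup>5))\<close>, and splitting the series of \<open>\<phi>(p)\<close> by residues modulo \<open>5\<close> gives
  \<open>\<phi>(p) = \<phi>(p\<^sup>2\<^sup>5) (1 + s + t)\<close>, where \<open>s\<close> and \<open>t\<close> are the fifth roots of the statement. Multiplying this
  dissection over all \<open>\<zeta> p\<close> with \<open>\<zeta>\<^sup>5 = 1\<close> and evaluating the left side by product formulas yields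
  \<open>1 - 5 s t + 5 (s t)\<^sup>2 + s\<^sup>5 + t\<^sup>5 = (\<phi>(P) / \<phi>(P\<^sup>5))\<^sup>6\<close>. Counting Gaussian integers modulo \<open>2 - i\<close>
  shows \<open>(\<phi>(P) / \<phi>(P\<^sup>5))\<^sup>2 = 1 + s t\<close>, so \<open>s\<^sup>5 + t\<^sup>5\<close> is a polynomial in \<open>s t\<close>. Finally the triple product
  and \<open>G(1/n) = G(n)\<close> give \<open>s t = 2 x\<close>, which determines the unordered pair \<open>s\<^sup>5, t\<^sup>5\<close>.
\<close>

section \<open>The Jacobi triple product\<close>

text \<open>The inversion is forced by the shape of the formula: dissecting the series at a nome q
  produces phi(q) / phi(q^25), while the statement has the reciprocal. Inversion makes the nomes
  trade places, and the factor 1/5 is what sqrt 25 leaves behind. The price is that x still lives at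
  the old nomes, so the class invariants have to be carried across as well; for this chi^6 is
  written through theta constants that are combinations of phi-values at t/4, t and 4t, a set of
  arguments stable under t -> 1/t. Replacing p by zeta p multiplies s by zeta and t by zeta^4 and
  fixes all functions of p^25, so the product over the fifth roots of unity is a norm that leaves
  only s t, s^5 and t^5. It lives over the complex numbers, hence the generic field in the series
  and product lemmas. With v = s t = 2x, the sum of s^5 and t^5 is v^3 - 2 v^2 + 8 v and their
  product is v^5; the square root in the statement comes from the discriminant of the corresponding
  quadratic. The triple product and the inversion both start from a finite identity and pass to the
  limit by dominated convergence of sums over the integers.\<close>

lemma tannery_has_sum:
  fixes f :: "nat \<Rightarrow> 'i \<Rightarrow> 'b :: banach"
  assumes has_sum: "\<And>n. n \<ge> N \<Longrightarrow> (f n has_sum S n) X"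
    and bound: "\<And>n x. n \<ge> N \<Longrightarrow> x \<in> X \<Longrightarrow> norm (f n x) \<le> M x"
    and M: "M summable_on X"
    and lim: "\<And>x. x \<in> X \<Longrightarrow> (\<lambda>n. f n x) \<longlonglongrightarrow> g x"
  shows "S \<longlonglongrightarrow> (\<Sum>\<^sub>\<infinity>x\<in>X. g x)"
proof (rule swap_uniform_limit')
  \<comment> \<open>By the Weierstrass M-test the finite partial sums converge uniformly in
    \<open>n\<close>, which allows the two limits to be exchanged.\<close>
  have "uniform_limit {N..} (\<lambda>X n. \<Sum>x\<in>X. f n x) S (finite_subsets_at_top X)"
    using bound has_sum M by (intro Weierstrass_m_test_general') auto
  then show "uniform_limit {N..} (\<lambda>X n. \<Sum>x\<in>X. f n x) S (finite_subsets_at_top X)" .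
  show "\<forall>\<^sub>F Y in finite_subsets_at_top X. ((\<lambda>n. \<Sum>x\<in>Y. f n x) \<longlongrightarrow> (\<Sum>x\<in>Y. g x)) sequentially"
    by (rule eventually_finite_subsets_at_top_weakI) (use lim in \<open>auto intro!: tendsto_sum\<close>)
  have "norm (g x) \<le> M x" if "x \<in> X" for x
    by (rule Lim_bounded[OF tendsto_norm[OF lim[OF that]], of N]) (use bound that in auto)
  with M have "(\<lambda>x. norm (g x)) summable_on X"
    by (rule Infinite_Sum.abs_summable_on_comparison_test')
  then show "((\<lambda>Y. \<Sum>x\<in>Y. g x) \<longlongrightarrow> infsum g X) (finite_subsets_at_top X)"
    by (rule infsum_tendsto[OF abs_summable_summable])
  show "\<forall>\<^sub>F n in sequentially. n \<in> {N..}"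
    using eventually_ge_at_top[of N] by simp
  show "\<not> trivial_limit (finite_subsets_at_top X)"
    by simp
qed

lemma summable_on_int_symmetric:
  fixes g :: "nat \<Rightarrow> real"
  assumes "summable g" "\<And>n. 0 \<le> g n"
  shows "(\<lambda>n::int. g (nat \<bar>n\<bar>)) summable_on UNIV"
proof -
  have g: "g summable_on UNIV"
    using assms by (intro summable_nonneg_imp_summable_on) auto
  have "(\<lambda>n::int. g (nat \<bar>n\<bar>)) summable_on range int"
    by (subst summable_on_reindex) (auto simp: inj_on_def o_def g)
  moreover have "(\<lambda>n::int. g (nat \<bar>n\<bar>)) summable_on range (\<lambda>n. - int n)"
    by (subst summable_on_reindex) (auto simp: inj_on_def o_def g)
  ultimately have "(\<lambda>n::int. g (nat \<bar>n\<bar>)) summable_on range int \<union> range (\<lambda>n. - int n)"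
    by (rule summable_on_union)
  also have "range int \<union> range (\<lambda>n. - int n) = UNIV"
  proof (intro equalityI subset_UNIV subsetI)
    fix n :: int
    show "n \<in> range int \<union> range (\<lambda>n. - int n)"
      by (cases n rule: int_cases2) auto
  qed
  finally show ?thesis .
qed

text \<open>The base on the right dominates both \<open>norm z\<close> and its inverse, so one
  majorant in \<open>nat \<bar>n\<bar>\<close> serves positive and negative exponents.\<close>

lemma norm_powi_le:
  fixes z :: "'a :: real_normed_field"
  assumes "z \<noteq> 0"
  shows "norm (z powi n) \<le> (norm z + inverse (norm z)) ^ nat \<bar>n\<bar>"
proof (cases "n \<ge> 0")
  case True
  then show ?thesis
    by (auto simp: power_int_nonneg_exp norm_power intro!: power_mono)
next
  case False
  then have "norm (z powi n) = inverse (norm z) ^ nat \<bar>n\<bar>"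
    by (auto simp: power_int_def norm_power norm_inverse)
  then show ?thesis
    by (auto intro!: power_mono)
qed

text \<open>The term is \<open>(r ^ n * w) ^ n\<close>, and \<open>r ^ n * w\<close> tends to 0, so
  a geometric series with ratio 1/2 eventually dominates.\<close>

lemma summable_square_power:
  fixes r w :: real
  assumes "0 \<le> r" "r < 1" "0 \<le> w"
  shows "summable (\<lambda>n::nat. r ^ n\<^sup>2 * w ^ n)"
proof -
  have "(\<lambda>n. r ^ n * w) \<longlonglongrightarrow> 0 * w"
    using assms by (intro tendsto_intros LIMSEQ_realpow_zero) auto
  then have "eventually (\<lambda>n. r ^ n * w < 1 / 2) sequentially"
    by (rule order_tendstoD) auto
  then have "eventually (\<lambda>n. norm (r ^ n\<^sup>2 * w ^ n) \<le> (1 / 2) ^ n) sequentially"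
  proof eventually_elim
    case (elim n)
    have "norm (r ^ n\<^sup>2 * w ^ n) = (r ^ n * w) ^ n"
      using assms by (simp add: power_mult_distrib power_mult[symmetric] power2_eq_square)
    also have "\<dots> \<le> (1 / 2) ^ n"
      using elim assms by (intro power_mono) auto
    finally show ?case .
  qed
  then show ?thesis
    by (rule summable_comparison_test_ev) auto
qed

lemma abs_summable_theta_terms:
  fixes q z :: "'a :: real_normed_field"
  assumes "norm q < 1" "z \<noteq> 0"
  shows "(\<lambda>n::int. norm (q powi n\<^sup>2 * z powi n)) summable_on UNIV"
proof (rule Infinite_Sum.abs_summable_on_comparison_test')
  let ?g = "\<lambda>n::nat. norm q ^ n\<^sup>2 * (norm z + inverse (norm z)) ^ n"
  show "(\<lambda>n::int. ?g (nat \<bar>n\<bar>)) summable_on UNIV"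
    using assms by (intro summable_on_int_symmetric summable_square_power) auto
  show "norm (q powi n\<^sup>2 * z powi n) \<le> ?g (nat \<bar>n\<bar>)" for n
  proof -
    have "nat (n\<^sup>2) = (nat \<bar>n\<bar>)\<^sup>2"
      by (metis abs_ge_zero nat_power_eq power2_abs)
    then have "norm (q powi n\<^sup>2) = norm q ^ (nat \<bar>n\<bar>)\<^sup>2"
      by (simp add: power_int_nonneg_exp norm_power)
    then show ?thesis
      using norm_powi_le[OF assms(2), of n] by (auto simp: norm_mult intro!: mult_mono)
  qed
qed

text \<open>Ramanujan's general theta function f(a, b) at a = q z, b = q / z; this parametrisation
  keeps all exponents integral.\<close>

definition jtheta :: "'a :: {real_normed_field, banach} \<Rightarrow> 'a \<Rightarrow> 'a" where
  "jtheta q z = (\<Sum>\<^sub>\<infinity>n\<in>(UNIV :: int set). q powi n\<^sup>2 * z powi n)"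

lemma has_sum_jtheta:
  assumes "norm q < 1" "z \<noteq> 0"
  shows "((\<lambda>n. q powi n\<^sup>2 * z powi n) has_sum jtheta q z) UNIV"
  unfolding jtheta_def
  by (rule has_sum_infsum[OF abs_summable_summable[OF abs_summable_theta_terms[OF assms]]])

lemma ramanujan_phi_eq_jtheta: "ramanujan_phi q = jtheta q 1"
  by (simp add: ramanujan_phi_def jtheta_def)

section \<open>Infinite q-Pochhammer products\<close>

lemma norm_power_less_one:
  fixes q :: "'a :: real_normed_field"
  assumes "norm q < 1" "n > 0"
  shows "norm (q ^ n) < 1"
  using assms by (simp add: norm_power power_less_one_iff)

lemma convergent_prod_qpochhammer:
  fixes a q :: "'a :: {real_normed_field, banach}"
  assumes "norm q < 1"
  shows "convergent_prod (\<lambda>k. 1 - a * q ^ k)"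
proof -
  have "summable (\<lambda>k. norm a * norm q ^ k)"
    using assms by (intro summable_mult summable_geometric) auto
  then have "abs_convergent_prod (\<lambda>k. 1 - a * q ^ k)"
    by (subst abs_convergent_prod_conv_summable) (simp add: norm_mult norm_power)
  then show ?thesis
    by (rule abs_convergent_prod_imp_convergent_prod)
qed

lemma qpochhammer_inf_tendsto:
  fixes a q :: "'a :: {real_normed_field, banach}"
  assumes "norm q < 1"
  shows "(\<lambda>n. \<Prod>k<n. 1 - a * q ^ k) \<longlonglongrightarrow> qpochhammer_inf a q"
proof -
  have "(\<lambda>n. \<Prod>k<Suc n. 1 - a * q ^ k) \<longlonglongrightarrow> qpochhammer_inf a q"
    unfolding qpochhammer_inf_def lessThan_Suc_atMost
    by (rule convergent_prod_LIMSEQ[OF convergent_prod_qpochhammer[OF assms]])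
  then show ?thesis
    by (rule LIMSEQ_imp_Suc)
qed

lemma qpochhammer_inf_nonzero:
  fixes a q :: "'a :: {real_normed_field, banach}"
  assumes "norm q < 1" "norm a < 1"
  shows "qpochhammer_inf a q \<noteq> 0"
  unfolding qpochhammer_inf_def
proof (rule prodinf_nonzero[OF convergent_prod_qpochhammer[OF assms(1)]])
  fix k
  have "norm (a * q ^ k) \<le> norm a * 1"
    unfolding norm_mult norm_power using assms by (intro mult_left_mono power_le_one) auto
  with assms show "1 - a * q ^ k \<noteq> 0"
    by force
qed

lemma prod_lessThan_mult:
  fixes f :: "nat \<Rightarrow> 'a :: comm_monoid_mult"
  shows "(\<Prod>k<m * n. f k) = (\<Prod>i<m. \<Prod>k<n. f (m * k + i))"
proof (induction n)
  case (Suc n)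
  have "(\<Prod>k<m * Suc n. f k) = (\<Prod>k<m * n. f k) * (\<Prod>k=m * n..<m * n + m. f k)"
    by (simp add: lessThan_atLeast0 prod.atLeastLessThan_concat add.commute)
  also have "(\<Prod>k=m * n..<m * n + m. f k) = (\<Prod>i<m. f (m * n + i))"
    using prod.shift_bounds_nat_ivl[of f 0 "m * n" m]
    by (simp add: lessThan_atLeast0 add.commute)
  finally show ?case
    using Suc by (simp add: prod.distrib)
qed simp

text \<open>The factors are sorted by the residue of the index modulo \<open>m\<close>; partial
  products of length \<open>m * n\<close> make the regrouping finite.\<close>

lemma qpochhammer_inf_split:
  fixes a q :: "'a :: {real_normed_field, banach}"
  assumes "norm q < 1" "m > 0"
  shows "qpochhammer_inf a q = (\<Prod>i<m. qpochhammer_inf (a * q ^ i) (q ^ m))"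
proof (rule LIMSEQ_unique)
  show "(\<lambda>n. \<Prod>k<m * n. 1 - a * q ^ k) \<longlonglongrightarrow> qpochhammer_inf a q"
    using LIMSEQ_subseq_LIMSEQ[OF qpochhammer_inf_tendsto[OF assms(1), of a], of "\<lambda>n. m * n"] assms
    by (auto simp: strict_mono_def o_def)
  have "(\<lambda>n. \<Prod>i<m. \<Prod>k<n. 1 - a * q ^ i * (q ^ m) ^ k)
          \<longlonglongrightarrow> (\<Prod>i<m. qpochhammer_inf (a * q ^ i) (q ^ m))"
    using assms by (intro tendsto_prod qpochhammer_inf_tendsto norm_power_less_one)
  then show "(\<lambda>n. \<Prod>k<m * n. 1 - a * q ^ k) \<longlonglongrightarrow> (\<Prod>i<m. qpochhammer_inf (a * q ^ i) (q ^ m))"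
    unfolding prod_lessThan_mult by (simp add: power_add power_mult[symmetric] mult_ac)
qed

lemma qpochhammer_inf_minus:
  fixes a q :: "'a :: {real_normed_field, banach}"
  assumes "norm q < 1"
  shows "qpochhammer_inf a q * qpochhammer_inf (- a) q = qpochhammer_inf (a\<^sup>2) (q\<^sup>2)"
proof (rule LIMSEQ_unique)
  show "(\<lambda>n. \<Prod>k<n. 1 - a\<^sup>2 * (q\<^sup>2) ^ k) \<longlonglongrightarrow> qpochhammer_inf (a\<^sup>2) (q\<^sup>2)"
    using assms by (intro qpochhammer_inf_tendsto norm_power_less_one) auto
  have "(\<lambda>n. (\<Prod>k<n. 1 - a * q ^ k) * (\<Prod>k<n. 1 - (- a) * q ^ k))
          \<longlonglongrightarrow> qpochhammer_inf a q * qpochhammer_inf (- a) q"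
    using assms by (intro tendsto_mult qpochhammer_inf_tendsto)
  also have "(\<lambda>n. (\<Prod>k<n. 1 - a * q ^ k) * (\<Prod>k<n. 1 - (- a) * q ^ k)) =
             (\<lambda>n. \<Prod>k<n. 1 - a\<^sup>2 * (q\<^sup>2) ^ k)"
  proof (rule ext, unfold prod.distrib[symmetric], rule prod.cong[OF refl])
    fix n k
    show "(1 - a * q ^ k) * (1 - - a * q ^ k) = 1 - a\<^sup>2 * (q\<^sup>2) ^ k"
      by (simp add: power2_eq_square algebra_simps power_mult_distrib)
  qed
  finally show "(\<lambda>n. \<Prod>k<n. 1 - a\<^sup>2 * (q\<^sup>2) ^ k)
      \<longlonglongrightarrow> qpochhammer_inf a q * qpochhammer_inf (- a) q" .
qed

text \<open>
  The finite form of the triple product. The reciprocals of the finite products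
  \<open>(1 - Q) \<dots> (1 - Q ^ m)\<close> are continued by \<open>0\<close> to negative \<open>m\<close>, which keeps
  \<open>qfact_inv_step\<close> valid for all integers and removes all boundary cases from the induction.
\<close>

definition qfact_inv :: "'a :: field \<Rightarrow> int \<Rightarrow> 'a" where
  "qfact_inv Q m = (if m < 0 then 0 else inverse (\<Prod>k<nat m. 1 - Q * Q ^ k))"

lemma qfact_inv_step:
  fixes Q :: "'a :: real_normed_field"
  assumes "norm Q < 1" "Q \<noteq> 0"
  shows "qfact_inv Q (m - 1) = (1 - Q powi m) * qfact_inv Q m"
proof (cases "m \<le> 0")
  case True
  then show ?thesis by (auto simp: qfact_inv_def)
next
  case False
  then obtain n where n: "m = int (Suc n)"
    by (metis gr0_implies_Suc not_le zero_less_imp_eq_int)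
  have "norm (Q ^ Suc n) < 1"
    using assms by (intro norm_power_less_one) auto
  then have "1 - Q ^ Suc n \<noteq> 0"
    by auto
  moreover have "qfact_inv Q (int (Suc n) - 1) = inverse (\<Prod>k<n. 1 - Q * Q ^ k)"
    by (simp add: qfact_inv_def)
  moreover have "qfact_inv Q (int (Suc n)) = inverse ((\<Prod>k<n. 1 - Q * Q ^ k) * (1 - Q ^ Suc n))"
    by (simp add: qfact_inv_def del: of_nat_Suc)
  ultimately show ?thesis
    unfolding n power_int_of_nat by (simp add: inverse_mult_distrib mult.left_commute)
qed

text \<open>This is \<open>q powi j\<^sup>2\<close> times the Gaussian binomial coefficient (2n
  choose n + j) in base \<open>q\<^sup>2\<close>.\<close>

definition jtp_coeff :: "'a :: field \<Rightarrow> nat \<Rightarrow> int \<Rightarrow> 'a" where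
  "jtp_coeff q n j = q powi j\<^sup>2 * (\<Prod>k<2 * n. 1 - q\<^sup>2 * (q\<^sup>2) ^ k) *
     (qfact_inv (q\<^sup>2) (int n - j) * qfact_inv (q\<^sup>2) (int n + j))"

text \<open>A Pascal-type recurrence. Every coefficient involved is a common factor \<open>K\<close>
  times a polynomial in \<open>u\<close>, \<open>v\<close> and \<open>1 / Q\<close>, where
  \<open>u * v\<close> is a power of \<open>Q\<close> that depends on \<open>n\<close> only; what
  remains is the polynomial identity \<open>e5\<close>.\<close>

lemma jtp_coeff_Suc:
  fixes q :: "'a :: real_normed_field"
  assumes "norm q < 1" "q \<noteq> 0"
  shows "jtp_coeff q (Suc n) j =
    (1 + q ^ (4 * n + 2)) * jtp_coeff q n j +
      q ^ (2 * n + 1) * (jtp_coeff q n (j - 1) + jtp_coeff q n (j + 1))"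
proof -
  define Q where "Q = q\<^sup>2"
  have Q: "norm Q < 1" "Q \<noteq> 0"
    unfolding Q_def using assms by (auto intro: norm_power_less_one)
  define R where "R = qfact_inv Q (int n + 1 - j)"
  define R' where "R' = qfact_inv Q (int n + 1 + j)"
  define u where "u = Q powi (int n + 1 - j)"
  define v where "v = Q powi (int n + 1 + j)"
  define A where "A = (\<Prod>k<2 * n. 1 - Q * Q ^ k)"
  note step = qfact_inv_step[OF Q]
  have uv: "u * v = Q ^ (2 * n + 2)"
  proof -
    have "(int n + 1 - j) + (int n + 1 + j) = int (2 * n + 2)"
      by simp
    then have "u * v = Q powi int (2 * n + 2)"
      unfolding u_def v_def using Q by (metis power_int_add)
    then show ?thesis
      by (simp only: power_int_of_nat)
  qed
  have R1: "qfact_inv Q (int n - j) = (1 - u) * R"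
    using step[of "int n + 1 - j"] by (simp add: R_def u_def algebra_simps)
  have R2: "qfact_inv Q (int n + j) = (1 - v) * R'"
    using step[of "int n + 1 + j"] by (simp add: R'_def v_def algebra_simps)
  have uQ: "Q powi (int n - j) = u / Q"
    using Q power_int_diff[of Q "int n + 1 - j" 1] by (simp add: u_def algebra_simps)
  have vQ: "Q powi (int n + j) = v / Q"
    using Q power_int_diff[of Q "int n + 1 + j" 1] by (simp add: v_def algebra_simps)
  have R3: "qfact_inv Q (int n - 1 - j) = (1 - u / Q) * ((1 - u) * R)"
    using step[of "int n - j"] unfolding R1 uQ by (simp add: algebra_simps)
  have R4: "qfact_inv Q (int n - 1 + j) = (1 - v / Q) * ((1 - v) * R')"
    using step[of "int n + j"] unfolding R2 vQ by (simp add: algebra_simps)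
  define p where "p = q powi j\<^sup>2"
  have Qq: "Q powi i = q powi (2 * i)" for i
    by (simp add: Q_def power_int_power)
  have p1: "q ^ (2 * n + 1) * q powi (j - 1)\<^sup>2 = u * p"
  proof -
    have "int (2 * n + 1) + (j - 1)\<^sup>2 = 2 * (int n + 1 - j) + j\<^sup>2"
      by (simp add: power2_eq_square algebra_simps)
    then have "q powi int (2 * n + 1) * q powi (j - 1)\<^sup>2 = u * p"
      unfolding p_def u_def Qq using assms by (metis power_int_add)
    then show ?thesis
      by (simp only: power_int_of_nat)
  qed
  have p2: "q ^ (2 * n + 1) * q powi (j + 1)\<^sup>2 = v * p"
  proof -
    have "int (2 * n + 1) + (j + 1)\<^sup>2 = 2 * (int n + 1 + j) + j\<^sup>2"
      by (simp add: power2_eq_square algebra_simps)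
    then have "q powi int (2 * n + 1) * q powi (j + 1)\<^sup>2 = v * p"
      unfolding p_def v_def Qq using assms by (metis power_int_add)
    then show ?thesis
      by (simp only: power_int_of_nat)
  qed
  define K where "K = p * A * (R * R')"
  have e0: "jtp_coeff q (Suc n) j = K * ((1 - u * v / Q) * (1 - u * v))"
  proof -
    have *: "int (Suc n) - j = int n + 1 - j" "int (Suc n) + j = int n + 1 + j"
      by simp_all
    have "(\<Prod>k<2 * Suc n. 1 - Q * Q ^ k) = A * ((1 - u * v / Q) * (1 - u * v))"
      unfolding uv A_def using Q by simp
    then show ?thesis
      unfolding jtp_coeff_def Q_def[symmetric] * by (simp add: K_def p_def R_def R'_def)
  qed
  have e1: "jtp_coeff q n j = K * ((1 - u) * (1 - v))"
    unfolding jtp_coeff_def Q_def[symmetric] R1 R2 by (simp add: K_def p_def A_def)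
  have e2: "q ^ (2 * n + 1) * jtp_coeff q n (j - 1) = K * (u * (1 - v / Q) * (1 - v))"
  proof -
    have *: "int n - (j - 1) = int n + 1 - j" "int n + (j - 1) = int n - 1 + j"
      by simp_all
    have "q ^ (2 * n + 1) * jtp_coeff q n (j - 1) = (q ^ (2 * n + 1) * q powi (j - 1)\<^sup>2) * A *
        (qfact_inv Q (int n + 1 - j) * qfact_inv Q (int n - 1 + j))"
      unfolding jtp_coeff_def Q_def[symmetric] * by (simp add: A_def)
    then show ?thesis
      unfolding p1 R4 by (simp add: R_def K_def)
  qed
  have e3: "q ^ (2 * n + 1) * jtp_coeff q n (j + 1) = K * (v * (1 - u / Q) * (1 - u))"
  proof -
    have *: "int n - (j + 1) = int n - 1 - j" "int n + (j + 1) = int n + 1 + j"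
      by simp_all
    have "q ^ (2 * n + 1) * jtp_coeff q n (j + 1) = (q ^ (2 * n + 1) * q powi (j + 1)\<^sup>2) * A *
        (qfact_inv Q (int n - 1 - j) * qfact_inv Q (int n + 1 + j))"
      unfolding jtp_coeff_def Q_def[symmetric] * by (simp add: A_def)
    then show ?thesis
      unfolding p2 R3 by (simp add: R'_def K_def)
  qed
  have "q ^ (4 * n + 2) * Q = (q\<^sup>2) ^ (2 * n + 2)"
    unfolding Q_def power_mult[symmetric] power_add[symmetric] by (simp add: algebra_simps)
  then have e4: "q ^ (4 * n + 2) = u * v / Q"
    unfolding uv Q_def using assms by (simp add: nonzero_eq_divide_eq)
  have e5: "(1 - u * v / Q) * (1 - u * v) =
      (1 + u * v / Q) * ((1 - u) * (1 - v)) + (u * (1 - v / Q) * (1 - v) + v * (1 - u / Q) * (1 - u))"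
  proof -
    have "(1 - u * v * i) * (1 - u * v) =
      (1 + u * v * i) * ((1 - u) * (1 - v)) + (u * (1 - v * i) * (1 - v) + v * (1 - u * i) * (1 - u))" for i
      by algebra
    then show ?thesis
      by (simp add: divide_inverse)
  qed
  have gen: "K * ((1 + w) * m + (a + b)) = (1 + w) * (K * m) + (K * a + K * b)" for w m a b
    by (simp add: algebra_simps)
  show ?thesis
    unfolding distrib_left[of "q ^ (2 * n + 1)"] e0 e1 e2 e3 e4 e5 by (rule gen)
qed

text \<open>Passing from \<open>n\<close> to \<open>Suc n\<close> multiplies by
  \<open>(1 + z * y) * (1 + y / z)\<close> with \<open>y = q ^ (2 * n + 1)\<close>, and
  \<open>jtp_coeff_Suc\<close> is this multiplication read off coefficientwise. Summing over all
  integers makes the shifts \<open>j - 1\<close> and \<open>j + 1\<close> plain bijections.\<close>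

lemma finite_triple_product:
  fixes q z :: "'a :: {real_normed_field, banach}"
  assumes q: "norm q < 1" "q \<noteq> 0" and z: "z \<noteq> 0"
  shows "((\<lambda>j. jtp_coeff q n j * z powi j) has_sum
    (\<Prod>k<n. 1 + z * q * (q\<^sup>2) ^ k) * (\<Prod>k<n. 1 + q / z * (q\<^sup>2) ^ k)) UNIV"
proof (induction n)
  case 0
  have "jtp_coeff q 0 j * z powi j = 0" if "j \<noteq> 0" for j
    using that by (auto simp: jtp_coeff_def qfact_inv_def)
  then show ?case
    by (intro has_sum_finite_neutralI[of "{0}"]) (auto simp: jtp_coeff_def qfact_inv_def)
next
  case (Suc n)
  let ?c = "\<lambda>j. jtp_coeff q n j * z powi j"
  define S where "S = (\<Prod>k<n. 1 + z * q * (q\<^sup>2) ^ k) * (\<Prod>k<n. 1 + q / z * (q\<^sup>2) ^ k)"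
  have c: "(?c has_sum S) UNIV"
    using Suc by (simp add: S_def)
  have c1: "((\<lambda>j. ?c (j - 1)) has_sum S) UNIV"
    using c by (subst has_sum_reindex_bij_witness[of _ "\<lambda>j. j + 1" "\<lambda>j. j - 1" UNIV ?c _ S]) auto
  have c2: "((\<lambda>j. ?c (j + 1)) has_sum S) UNIV"
    using c by (subst has_sum_reindex_bij_witness[of _ "\<lambda>j. j - 1" "\<lambda>j. j + 1" UNIV ?c _ S]) auto
  define y where "y = q ^ (2 * n + 1)"
  have y2: "q ^ (4 * n + 2) = y * y" and yq: "q * (q\<^sup>2) ^ n = y"
    unfolding y_def power_mult[symmetric] power_add[symmetric] by (simp_all add: algebra_simps)
  have "((\<lambda>j. (1 + y * y) * ?c j + (y * z * ?c (j - 1) + y / z * ?c (j + 1))) has_sum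
      (1 + y * y) * S + (y * z * S + y / z * S)) UNIV"
    by (intro has_sum_add has_sum_cmult_right c c1 c2)
  also have "(\<lambda>j. (1 + y * y) * ?c j + (y * z * ?c (j - 1) + y / z * ?c (j + 1))) =
      (\<lambda>j. jtp_coeff q (Suc n) j * z powi j)"
  proof
    fix j
    have "z powi (j - 1) = z powi j / z" "z powi (j + 1) = z powi j * z"
      using z by (simp_all add: power_int_add power_int_diff)
    then show "(1 + y * y) * ?c j + (y * z * ?c (j - 1) + y / z * ?c (j + 1)) =
        jtp_coeff q (Suc n) j * z powi j"
      unfolding jtp_coeff_Suc[OF q] y2 y_def[symmetric] using z
      by (simp add: distrib_left distrib_right)
  qed
  also have "(1 + y * y) * S + (y * z * S + y / z * S) = S * ((1 + z * y) * (1 + y / z))"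
    using z by (simp add: field_simps)
  also have "\<dots> = (\<Prod>k<Suc n. 1 + z * q * (q\<^sup>2) ^ k) * (\<Prod>k<Suc n. 1 + q / z * (q\<^sup>2) ^ k)"
    unfolding yq[symmetric] by (simp add: S_def)
  finally show ?case .
qed

text \<open>Limit of the finite form. For fixed \<open>j\<close> the Gaussian binomial tends to
  \<open>E * inverse E * inverse E = inverse E\<close>; since the partial products and their
  inverses are bounded, a constant multiple of the theta series is a majorant.\<close>

theorem jacobi_triple_product:
  fixes q z :: "'a :: {real_normed_field, banach}"
  assumes q: "norm q < 1" "q \<noteq> 0" and z: "z \<noteq> 0"
  shows "jtheta q z =
    qpochhammer_inf (q\<^sup>2) (q\<^sup>2) * (qpochhammer_inf (- (z * q)) (q\<^sup>2) * qpochhammer_inf (- (q / z)) (q\<^sup>2))"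
proof -
  define Q where "Q = q\<^sup>2"
  have Q: "norm Q < 1" "Q \<noteq> 0"
    unfolding Q_def using q by (auto intro: norm_power_less_one)
  define E where "E = qpochhammer_inf Q Q"
  have E: "E \<noteq> 0"
    unfolding E_def using Q by (intro qpochhammer_inf_nonzero)
  have lim: "(\<lambda>n. \<Prod>k<n. 1 - Q * Q ^ k) \<longlonglongrightarrow> E"
    unfolding E_def by (intro qpochhammer_inf_tendsto Q)
  have lim_inv: "(\<lambda>n. inverse (\<Prod>k<n. 1 - Q * Q ^ k)) \<longlonglongrightarrow> inverse E"
    by (intro tendsto_inverse lim E)
  have "Bseq (\<lambda>n. \<Prod>k<n. 1 - Q * Q ^ k)"
    by (rule convergent_imp_Bseq[OF convergentI[OF lim]])
  then obtain B where B: "B > 0" "\<And>n. norm (\<Prod>k<n. 1 - Q * Q ^ k) \<le> B"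
    by (auto simp: Bseq_def)
  have "Bseq (\<lambda>n. inverse (\<Prod>k<n. 1 - Q * Q ^ k))"
    by (rule convergent_imp_Bseq[OF convergentI[OF lim_inv]])
  then obtain C where C: "C > 0" "\<And>n. norm (inverse (\<Prod>k<n. 1 - Q * Q ^ k)) \<le> C"
    by (auto simp: Bseq_def)
  have C': "norm (qfact_inv Q m) \<le> C" for m
    using C by (auto simp: qfact_inv_def intro: less_imp_le)
  have lim_qf: "(\<lambda>n. qfact_inv Q (int n + j)) \<longlonglongrightarrow> inverse E" for j
  proof -
    have "filterlim (\<lambda>n. nat (int n + j)) at_top sequentially"
      unfolding filterlim_at_top
    proof
      fix Z
      show "\<forall>\<^sub>F n in sequentially. Z \<le> nat (int n + j)"
        using eventually_ge_at_top[of "Z + nat \<bar>j\<bar>"] by eventually_elim linarith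
    qed
    then have "(\<lambda>n. inverse (\<Prod>k<nat (int n + j). 1 - Q * Q ^ k)) \<longlonglongrightarrow> inverse E"
      by (rule filterlim_compose[OF lim_inv])
    moreover have "\<forall>\<^sub>F n in sequentially. inverse (\<Prod>k<nat (int n + j). 1 - Q * Q ^ k) = qfact_inv Q (int n + j)"
      using eventually_ge_at_top[of "nat \<bar>j\<bar>"] by eventually_elim (auto simp: qfact_inv_def)
    ultimately show ?thesis
      by (rule Lim_transform_eventually)
  qed
  have "(\<lambda>n. (\<Prod>k<n. 1 + z * q * Q ^ k) * (\<Prod>k<n. 1 + q / z * Q ^ k)) \<longlonglongrightarrow>
      (\<Sum>\<^sub>\<infinity>j\<in>UNIV. inverse E * (q powi j\<^sup>2 * z powi j))"
  proof (rule tannery_has_sum[where N = 0])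
    show "((\<lambda>j. jtp_coeff q n j * z powi j) has_sum
        (\<Prod>k<n. 1 + z * q * Q ^ k) * (\<Prod>k<n. 1 + q / z * Q ^ k)) UNIV" for n
      unfolding Q_def by (rule finite_triple_product[OF assms])
    show "norm (jtp_coeff q n j * z powi j) \<le> (B * (C * C)) * norm (q powi j\<^sup>2 * z powi j)" for n j
    proof -
      have "norm (jtp_coeff q n j * z powi j) =
        (norm (\<Prod>k<2 * n. 1 - Q * Q ^ k) * (norm (qfact_inv Q (int n - j)) * norm (qfact_inv Q (int n + j))))
         * norm (q powi j\<^sup>2 * z powi j)"
        by (simp add: jtp_coeff_def norm_mult Q_def mult_ac)
      also have "\<dots> \<le> (B * (C * C)) * norm (q powi j\<^sup>2 * z powi j)"
        using B C C' by (intro mult_right_mono mult_mono) (auto intro: less_imp_le)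
      finally show ?thesis .
    qed
    show "(\<lambda>j. (B * (C * C)) * norm (q powi j\<^sup>2 * z powi j)) summable_on UNIV"
      by (intro summable_on_cmult_right abs_summable_theta_terms q z)
    show "(\<lambda>n. jtp_coeff q n j * z powi j) \<longlonglongrightarrow> inverse E * (q powi j\<^sup>2 * z powi j)" for j
    proof -
      have lim2: "(\<lambda>n. \<Prod>k<2 * n. 1 - Q * Q ^ k) \<longlonglongrightarrow> E"
        using LIMSEQ_subseq_LIMSEQ[OF lim, of "\<lambda>n. 2 * n"] by (simp add: strict_mono_def o_def)
      have "(\<lambda>n. q powi j\<^sup>2 * (\<Prod>k<2 * n. 1 - Q * Q ^ k) *
          (qfact_inv Q (int n + - j) * qfact_inv Q (int n + j)) * z powi j)
          \<longlonglongrightarrow> q powi j\<^sup>2 * E * (inverse E * inverse E) * z powi j"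
        by (intro tendsto_intros lim2 lim_qf)
      moreover have "q powi j\<^sup>2 * E * (inverse E * inverse E) * z powi j = inverse E * (q powi j\<^sup>2 * z powi j)"
        using E by (simp add: field_simps)
      ultimately show ?thesis
        by (simp add: jtp_coeff_def Q_def)
    qed
  qed
  also have "(\<Sum>\<^sub>\<infinity>j\<in>UNIV. inverse E * (q powi j\<^sup>2 * z powi j)) = inverse E * jtheta q z"
    by (simp add: jtheta_def infsum_cmult_right')
  finally have lim1: "(\<lambda>n. (\<Prod>k<n. 1 + z * q * Q ^ k) * (\<Prod>k<n. 1 + q / z * Q ^ k)) \<longlonglongrightarrow>
      inverse E * jtheta q z" .
  have lim2: "(\<lambda>n. (\<Prod>k<n. 1 + z * q * Q ^ k) * (\<Prod>k<n. 1 + q / z * Q ^ k)) \<longlonglongrightarrow>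
      qpochhammer_inf (- (z * q)) Q * qpochhammer_inf (- (q / z)) Q"
    using tendsto_mult[OF qpochhammer_inf_tendsto[OF Q(1), of "- (z * q)"]
        qpochhammer_inf_tendsto[OF Q(1), of "- (q / z)"]] by simp
  have "inverse E * jtheta q z = qpochhammer_inf (- (z * q)) Q * qpochhammer_inf (- (q / z)) Q"
    by (rule LIMSEQ_unique[OF lim1 lim2])
  then show ?thesis
    using E by (simp add: E_def Q_def field_simps)
qed

section \<open>Theta inversion\<close>

text \<open>Orthogonality of the \<open>n\<close>-th roots of unity, by the geometric sum. The
  window from \<open>-N\<close> to \<open>N\<close> keeps the angles \<open>pi * l / n\<close> used
  later inside (-pi/2, pi/2), where powers of the cosine have a Gaussian bound.\<close>

lemma sum_cis_roots:
  assumes n: "n = 2 * N + 1"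
  shows "(\<Sum>l=-int N..int N. cis (2 * pi * of_int l * of_int k / real n)) =
    (if int n dvd k then of_nat n else 0)"
proof (cases "int n dvd k")
  case True
  then obtain x where x: "k = int n * x"
    by blast
  have "cis (2 * pi * of_int l * of_int k / real n) = 1" for l :: int
  proof -
    have "2 * pi * of_int l * of_int k / real n = 2 * pi * of_int (l * x)"
      using n by (simp add: x)
    then show ?thesis
      by (metis Ints_of_int cis_multiple_2pi)
  qed
  then show ?thesis
    using True n by simp
next
  case False
  define w where "w = cis (2 * pi * of_int k / real n)"
  have npos: "n > 0"
    using n by simp
  have "w \<noteq> 1"
  proof
    assume "w = 1"
    then have "cos (2 * pi * of_int k / real n) = 1"
      by (simp add: w_def complex_eq_iff)
    then obtain x :: int where "2 * pi * of_int k / real n = of_int x * 2 * pi"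
      by (auto simp: cos_one_2pi_int)
    then have "real_of_int k = of_int (int n * x)"
      using npos by (simp add: field_simps)
    then show False
      using False by (metis dvd_triv_left of_int_eq_iff)
  qed
  have "w ^ n = cis (2 * pi * of_int k)"
    unfolding w_def Complex.DeMoivre using npos by simp
  also have "\<dots> = 1"
    by (rule cis_multiple_2pi) auto
  finally have "w ^ n = 1" .
  have "(\<Sum>l=-int N..int N. cis (2 * pi * of_int l * of_int k / real n)) =
      (\<Sum>a<n. cis (2 * pi * of_int (int a - int N) * of_int k / real n))"
    by (rule sum.reindex_bij_witness[of _ "\<lambda>a. int a - int N" "\<lambda>l. nat (l + int N)"]) (auto simp: n)
  also have "\<dots> = (\<Sum>a<n. w ^ a * cis (- (2 * pi * real N * of_int k / real n)))"
    unfolding w_def Complex.DeMoivre cis_mult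
    by (intro sum.cong refl arg_cong[of _ _ cis]) (simp add: diff_divide_distrib algebra_simps)
  also have "\<dots> = 0"
    using \<open>w \<noteq> 1\<close> \<open>w ^ n = 1\<close> geometric_sum[of w n] by (simp flip: sum_distrib_right)
  finally show ?thesis
    using False by simp
qed

text \<open>The coefficient of z^k in (sqrt z + 1 / sqrt z)^(2m); the extension by 0 permits sums
  over all integers.\<close>

definition central_binom :: "nat \<Rightarrow> int \<Rightarrow> real" where
  "central_binom m k = (if \<bar>k\<bar> \<le> int m then real ((2 * m) choose (nat (int m + k))) else 0)"

lemma cos_power_expansion:
  "complex_of_real ((2 * cos x) ^ (2 * m)) =
    (\<Sum>k=-int m..int m. of_real (central_binom m k) * cis (2 * x * of_int k))"
proof -
  have "complex_of_real ((2 * cos x) ^ (2 * m)) = (cis x + cis (- x)) ^ (2 * m)"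
    by (simp add: cis.ctr complex_eq_iff Complex_eq flip: of_real_power)
  also have "\<dots> = (\<Sum>i\<le>2 * m. of_nat ((2 * m) choose i) * cis x ^ i * cis (- x) ^ (2 * m - i))"
    by (rule binomial_ring)
  also have "\<dots> = (\<Sum>i\<le>2 * m. of_nat ((2 * m) choose i) * cis (2 * x * of_int (int i - int m)))"
  proof (rule sum.cong[OF refl])
    fix i assume "i \<in> {..2 * m}"
    then have "cis x ^ i * cis (- x) ^ (2 * m - i) = cis (2 * x * of_int (int i - int m))"
      unfolding Complex.DeMoivre cis_mult
      by (intro arg_cong[of _ _ cis]) (simp add: of_nat_diff algebra_simps)
    then show "of_nat ((2 * m) choose i) * cis x ^ i * cis (- x) ^ (2 * m - i) =
        of_nat ((2 * m) choose i) * cis (2 * x * of_int (int i - int m))"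
      by (simp add: mult.assoc)
  qed
  also have "\<dots> = (\<Sum>k=-int m..int m. of_real (central_binom m k) * cis (2 * x * of_int k))"
    by (rule sum.reindex_bij_witness[of _ "\<lambda>k. nat (k + int m)" "\<lambda>i. int i - int m"])
       (auto simp: central_binom_def)
  finally show ?thesis .
qed

text \<open>
  Polya's proof of theta inversion: average \<open>(\<surd>z + 1 / \<surd>z)\<^sup>2\<^sup>m\<close> over the \<open>n\<close>-th roots of unity and let
  \<open>n\<close> tend to infinity with \<open>m \<sim> s n\<^sup>2\<close>.
\<close>

lemma polya_identity:
  assumes n: "n = 2 * N + 1"
  shows "((\<lambda>j. real n * central_binom m (j * int n)) has_sum
    (\<Sum>l=-int N..int N. (2 * cos (pi * of_int l / real n)) ^ (2 * m))) UNIV"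
proof -
  have npos: "int n > 0"
    using n by simp
  define B where "B = {j::int. \<bar>j * int n\<bar> \<le> int m}"
  have "B \<subseteq> {- int m..int m}"
  proof
    fix j assume "j \<in> B"
    then have "\<bar>j\<bar> * int n \<le> int m"
      using npos by (simp add: B_def abs_mult)
    moreover have "\<bar>j\<bar> * 1 \<le> \<bar>j\<bar> * int n"
      using npos by (intro mult_left_mono) auto
    ultimately show "j \<in> {- int m..int m}"
      by auto
  qed
  then have fin: "finite B"
    using finite_subset by blast
  have "complex_of_real (\<Sum>l=-int N..int N. (2 * cos (pi * of_int l / real n)) ^ (2 * m)) =
      (\<Sum>l=-int N..int N. \<Sum>k=-int m..int m.
        of_real (central_binom m k) * cis (2 * pi * of_int l * of_int k / real n))"
    by (simp only: of_real_sum cos_power_expansion) (simp add: mult_ac)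
  also have "\<dots> = (\<Sum>k=-int m..int m. of_real (central_binom m k) *
      (\<Sum>l=-int N..int N. cis (2 * pi * of_int l * of_int k / real n)))"
    by (subst sum.swap) (simp add: sum_distrib_left)
  also have "\<dots> = (\<Sum>k=-int m..int m. of_real (if int n dvd k then real n * central_binom m k else 0))"
    by (intro sum.cong refl) (simp add: sum_cis_roots[OF n])
  also have "\<dots> = of_real (\<Sum>k=-int m..int m. if int n dvd k then real n * central_binom m k else 0)"
    by simp
  finally have "(\<Sum>l=-int N..int N. (2 * cos (pi * of_int l / real n)) ^ (2 * m)) =
      (\<Sum>k=-int m..int m. if int n dvd k then real n * central_binom m k else 0)"
    by (simp only: of_real_eq_iff)
  also have "\<dots> = (\<Sum>k\<in>{k \<in> {-int m..int m}. int n dvd k}. real n * central_binom m k)"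
    by (rule sum.inter_filter[symmetric]) simp
  also have "\<dots> = (\<Sum>j\<in>B. real n * central_binom m (j * int n))"
    by (rule sum.reindex_bij_witness[of _ "\<lambda>j. j * int n" "\<lambda>k. k div int n"])
       (use npos in \<open>auto simp: B_def\<close>)
  finally show ?thesis
    by (intro has_sum_finite_neutralI[OF fin]) (auto simp: B_def central_binom_def)
qed

text \<open>Supplies the majorant for \<open>cos_side\<close>. The function
  \<open>cos y * exp (y\<^sup>2 / 2)\<close> decreases from 1 on [0, pi/2] because
  \<open>y * cos y \<le> sin y\<close> there.\<close>

lemma cos_le_exp:
  assumes "\<bar>x\<bar> \<le> pi / 2"
  shows "\<bar>cos x\<bar> \<le> exp (- x\<^sup>2 / 2)"
proof -
  have *: "cos y \<le> exp (- y\<^sup>2 / 2)" if y: "0 \<le> y" "y \<le> pi / 2" for y :: real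
  proof -
    have sin: "t * cos t \<le> sin t" if "0 \<le> t" "t \<le> pi / 2" for t
    proof -
      have "sin 0 - 0 * cos 0 \<le> sin t - t * cos t"
      proof (rule DERIV_nonneg_imp_nondecreasing[OF that(1)])
        fix u assume u: "0 \<le> u" "u \<le> t"
        have "((\<lambda>t. sin t - t * cos t) has_real_derivative u * sin u) (at u)"
          by (auto intro!: derivative_eq_intros)
        moreover have "u * sin u \<ge> 0"
          using u that pi_gt_zero by (intro mult_nonneg_nonneg sin_ge_zero) linarith+
        ultimately show "\<exists>y. ((\<lambda>t. sin t - t * cos t) has_real_derivative y) (at u) \<and> 0 \<le> y"
          by blast
      qed
      then show ?thesis
        by simp
    qed
    have "cos y * exp (y\<^sup>2 / 2) \<le> cos 0 * exp (0\<^sup>2 / 2)"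
    proof (rule DERIV_nonpos_imp_nonincreasing[OF y(1)])
      fix u assume u: "0 \<le> u" "u \<le> y"
      have "((\<lambda>t. cos t * exp (t\<^sup>2 / 2)) has_real_derivative (u * cos u - sin u) * exp (u\<^sup>2 / 2)) (at u)"
        by (auto intro!: derivative_eq_intros simp: algebra_simps)
      moreover have "(u * cos u - sin u) * exp (u\<^sup>2 / 2) \<le> 0"
        using sin[of u] u y by (intro mult_nonpos_nonneg) auto
      ultimately show "\<exists>z. ((\<lambda>t. cos t * exp (t\<^sup>2 / 2)) has_real_derivative z) (at u) \<and> z \<le> 0"
        by blast
    qed
    then show ?thesis
      by (simp add: exp_minus field_simps)
  qed
  have "cos x \<ge> 0"
    using assms by (intro cos_ge_zero) auto
  then show ?thesis
    using *[of "\<bar>x\<bar>"] assms by simp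
qed

section \<open>Estimates for central binomial coefficients\<close>

text \<open>Consecutive coefficients have ratio (m - i) / (m + i + 1), that is 1 - (2i + 1) / (m + i
  + 1), with reciprocal 1 + (2i + 1) / (m - i). Replacing the denominators by the extreme values m +
  k and m + 1 - k and using 1 + y <= exp y turns the product over i < k into an exponential, where
  the odd numbers 2i + 1 add up to k^2.\<close>

lemma central_ratio_bounds:
  assumes "k \<le> m"
  shows "real ((2 * m) choose (m + k)) \<le> real ((2 * m) choose m) * exp (- (real k)\<^sup>2 / (real m + real k))"
    and "real ((2 * m) choose m) * exp (- (real k)\<^sup>2 / (real m + 1 - real k)) \<le> real ((2 * m) choose (m + k))"
proof -
  have step: "real ((2 * m) choose (m + Suc i)) = real ((2 * m) choose (m + i)) * ((real m - real i) / (real m + real i + 1))"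
    if "i < m" for i
  proof -
    have "Suc (m + i) * ((2 * m) choose Suc (m + i)) = (m - i) * ((2 * m) choose (m + i))"
      using binomial_absorb_comp[of "2 * m" "m + i"] binomial_absorption[of "m + i" "2 * m"]
      by (simp add: mult_2)
    then have "real (Suc (m + i)) * real ((2 * m) choose Suc (m + i)) = real (m - i) * real ((2 * m) choose (m + i))"
      by (metis of_nat_mult)
    then show ?thesis
      using that by (simp add: field_simps of_nat_diff)
  qed
  have "real ((2 * m) choose (m + i)) \<le> real ((2 * m) choose m) * exp (- (real i)\<^sup>2 / (real m + real k))"
    if "i \<le> k" for i
    using that
  proof (induction i)
    case (Suc i)
    define y where "y = (2 * real i + 1) / (real m + real k)"
    have "(2 * real i + 1) / (real m + real k) \<le> (2 * real i + 1) / (real m + real i + 1)"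
      using Suc.prems by (intro divide_left_mono) auto
    then have "(real m - real i) / (real m + real i + 1) \<le> 1 - y"
      unfolding y_def by (simp add: field_simps)
    also have "1 - y \<le> exp (- y)"
      using exp_ge_add_one_self[of "- y"] by simp
    finally have y: "(real m - real i) / (real m + real i + 1) \<le> exp (- y)" .
    have "real ((2 * m) choose (m + Suc i)) \<le>
        (real ((2 * m) choose m) * exp (- (real i)\<^sup>2 / (real m + real k))) * exp (- y)"
      using Suc assms y by (subst step) (auto intro!: mult_mono simp del: times_divide_eq_right)
    also have "\<dots> = real ((2 * m) choose m) * exp (- (real (Suc i))\<^sup>2 / (real m + real k))"
      by (simp add: y_def mult.assoc flip: exp_add)
         (simp add: power2_eq_square algebra_simps diff_divide_distrib add_divide_distrib)
    finally show ?case .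
  qed simp
  from this[of k] show "real ((2 * m) choose (m + k)) \<le> real ((2 * m) choose m) * exp (- (real k)\<^sup>2 / (real m + real k))"
    by simp
  have "real ((2 * m) choose m) * exp (- (real i)\<^sup>2 / (real m + 1 - real k)) \<le> real ((2 * m) choose (m + i))"
    if "i \<le> k" for i
    using that
  proof (induction i)
    case (Suc i)
    define y where "y = (2 * real i + 1) / (real m + 1 - real k)"
    have "1 + (2 * real i + 1) / (real m - real i) \<le> 1 + y"
      using Suc.prems assms unfolding y_def by (intro add_left_mono divide_left_mono) auto
    also have "1 + y \<le> exp y"
      by (rule exp_ge_add_one_self)
    finally have "(real m + real i + 1) / (real m - real i) \<le> exp y"
      using Suc.prems assms by (simp add: field_simps)
    then have y: "exp (- y) \<le> (real m - real i) / (real m + real i + 1)"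
      using Suc.prems assms by (simp add: exp_minus field_simps)
    have "real ((2 * m) choose m) * exp (- (real (Suc i))\<^sup>2 / (real m + 1 - real k)) =
        (real ((2 * m) choose m) * exp (- (real i)\<^sup>2 / (real m + 1 - real k))) * exp (- y)"
      by (simp add: y_def mult.assoc flip: exp_add)
         (simp add: power2_eq_square algebra_simps diff_divide_distrib add_divide_distrib)
    also have "\<dots> \<le> real ((2 * m) choose (m + Suc i))"
      using Suc assms y by (subst step) (auto intro!: mult_mono simp del: times_divide_eq_right)
    finally show ?case .
  qed simp
  from this[of k] show "real ((2 * m) choose m) * exp (- (real k)\<^sup>2 / (real m + 1 - real k)) \<le> real ((2 * m) choose (m + k))"
    by simp
qed

lemma central_binom_nat:
  "central_binom m k = (if nat \<bar>k\<bar> \<le> m then real ((2 * m) choose (m + nat \<bar>k\<bar>)) else 0)"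
proof (cases "k \<ge> 0")
  case True
  then show ?thesis
    by (auto simp: central_binom_def nat_add_distrib)
next
  case False
  show ?thesis
  proof (cases "nat \<bar>k\<bar> \<le> m")
    case True
    have "nat (int m + k) = 2 * m - (m + nat \<bar>k\<bar>)"
      using True False by linarith
    then have "(2 * m) choose (nat (int m + k)) = (2 * m) choose (m + nat \<bar>k\<bar>)"
      using True by (metis binomial_symmetric add_le_mono1 mult_2 add_left_mono)
    then show ?thesis
      using True by (simp add: central_binom_def)
  qed (auto simp: central_binom_def)
qed

text \<open>With p = (2m choose m) / 4^m, the sequence m p^2 increases, while (2m + 1) p^2 never
  exceeds its initial value 1. Monotone convergence gives a limit without Stirling's
  formula.\<close>

lemma convergent_central_binomial:
  "convergent (\<lambda>m. sqrt m * (real ((2 * m) choose m) / 4 ^ m))"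
proof -
  define p where "p m = real ((2 * m) choose m) / 4 ^ m" for m
  have p_Suc: "p (Suc m) = p m * ((2 * real m + 1) / (2 * real m + 2))" for m
  proof -
    have "Suc m * ((2 * Suc m) choose Suc m) = Suc (Suc (2 * m)) * (Suc (2 * m) choose m)"
      using Suc_times_binomial[of m "Suc (2 * m)"] by simp
    moreover have "Suc m * (Suc (2 * m) choose m) = Suc (2 * m) * ((2 * m) choose m)"
      using binomial_absorb_comp[of "Suc (2 * m)" m] by (simp add: Suc_diff_le)
    ultimately have "Suc m * (Suc m * ((2 * Suc m) choose Suc m)) =
        Suc (Suc (2 * m)) * (Suc (2 * m) * ((2 * m) choose m))"
      by (metis mult.left_commute)
    moreover have "a * x = 2 * y" if "a * (a * x) = 2 * a * y" "a > 0" for a x y :: nat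
      using that by (metis mult.assoc mult.commute mult_left_cancel not_less0)
    moreover have "Suc (Suc (2 * m)) = 2 * Suc m"
      by simp
    ultimately have "Suc m * ((2 * Suc m) choose Suc m) = 2 * (Suc (2 * m) * ((2 * m) choose m))"
      by (metis zero_less_Suc)
    then have "real (Suc m) * real ((2 * Suc m) choose Suc m) = 2 * (real (Suc (2 * m)) * real ((2 * m) choose m))"
      by (metis of_nat_mult of_nat_numeral)
    then have "real ((2 * Suc m) choose Suc m) = 2 * (real (Suc (2 * m)) * real ((2 * m) choose m)) / real (Suc m)"
      by (simp add: nonzero_eq_divide_eq mult.commute del: binomial_Suc_Suc)
    then have "p (Suc m) = 2 * (real (Suc (2 * m)) * real ((2 * m) choose m)) / real (Suc m) / (4 * 4 ^ m)"
      unfolding p_def by (simp only: power_Suc)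
    also have "\<dots> = p m * (real (Suc (2 * m)) / (2 * real (Suc m)))"
      by (simp add: p_def mult_ac del: of_nat_Suc)
    finally show ?thesis
      by (simp add: algebra_simps)
  qed
  have p_pos: "p m \<ge> 0" for m
    by (simp add: p_def)
  have p1: "(2 * real m + 1) * (p m)\<^sup>2 \<le> 1" for m
  proof (induction m)
    case (Suc m)
    have "(2 * real (Suc m) + 1) * (p (Suc m))\<^sup>2 =
      ((2 * real m + 1) * (p m)\<^sup>2) * (((2 * real m + 3) * (2 * real m + 1)) / (2 * real m + 2)\<^sup>2)"
      by (simp add: p_Suc power2_eq_square field_simps)
    also have "\<dots> \<le> 1 * 1"
    proof (intro mult_mono)
      have "(2 * real m + 3) * (2 * real m + 1) \<le> (2 * real m + 2)\<^sup>2"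
        by (simp add: power2_eq_square algebra_simps)
      then show "(2 * real m + 3) * (2 * real m + 1) / (2 * real m + 2)\<^sup>2 \<le> 1"
        by (subst divide_le_eq_1_pos) auto
    qed (use Suc in auto)
    finally show ?case by simp
  qed (simp add: p_def)
  have "incseq (\<lambda>m. real m * (p m)\<^sup>2)"
  proof (rule incseq_SucI)
    fix m
    have "real m \<le> real (Suc m) * ((2 * real m + 1) / (2 * real m + 2))\<^sup>2"
    proof -
      have "real m * (2 * real m + 2)\<^sup>2 \<le> real (Suc m) * (2 * real m + 1)\<^sup>2"
        by (simp add: power2_eq_square algebra_simps)
      then have "real m \<le> real (Suc m) * (2 * real m + 1)\<^sup>2 / (2 * real m + 2)\<^sup>2"
        by (subst pos_le_divide_eq) auto
      then show ?thesis
        by (simp add: power_divide)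
    qed
    then have "real m * (p m)\<^sup>2 \<le> (real (Suc m) * ((2 * real m + 1) / (2 * real m + 2))\<^sup>2) * (p m)\<^sup>2"
      by (rule mult_right_mono) simp
    then show "real m * (p m)\<^sup>2 \<le> real (Suc m) * (p (Suc m))\<^sup>2"
      by (simp add: p_Suc power_mult_distrib power_divide mult_ac)
  qed
  moreover have "real m * (p m)\<^sup>2 \<le> 1" for m
    using p1[of m] by (auto simp: algebra_simps intro: order_trans[rotated])
  ultimately obtain L where "(\<lambda>m. real m * (p m)\<^sup>2) \<longlonglongrightarrow> L"
    using incseq_convergent[of "\<lambda>m. real m * (p m)\<^sup>2" 1] by blast
  then have "(\<lambda>m. sqrt (real m * (p m)\<^sup>2)) \<longlonglongrightarrow> sqrt L"
    by (rule tendsto_real_sqrt)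
  then show ?thesis
    using p_pos by (auto simp: real_sqrt_mult p_def convergent_def)
qed

definition gauss_theta :: "real \<Rightarrow> real" where
  "gauss_theta a = ramanujan_phi (exp (- a))"

lemma has_sum_gauss_theta:
  assumes "a > 0"
  shows "((\<lambda>j::int. exp (- a * (of_int j)\<^sup>2)) has_sum gauss_theta a) UNIV"
proof -
  have "exp (- a) powi j\<^sup>2 * 1 powi j = exp (- a * (of_int j)\<^sup>2)" for j :: int
    by (simp add: exp_power_int mult.commute)
  then show ?thesis
    using has_sum_jtheta[of "exp (- a)" 1] assms
    by (simp add: gauss_theta_def ramanujan_phi_eq_jtheta)
qed

lemma gauss_theta_pos:
  assumes "a > 0"
  shows "gauss_theta a > 0"
proof -
  have "(\<Sum>j\<in>{0::int}. exp (- a * (of_int j)\<^sup>2)) \<le> gauss_theta a"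
    by (rule finite_sum_le_has_sum[OF has_sum_gauss_theta[OF assms]]) auto
  then show ?thesis
    by simp
qed

section \<open>The two limits of Polya's identity\<close>

context
  fixes s :: real and n m :: "nat \<Rightarrow> nat"
  assumes s: "s > 0"
  defines "n \<equiv> \<lambda>N. 2 * N + 1" and "m \<equiv> \<lambda>N. nat \<lceil>s * (real (n N))\<^sup>2\<rceil>"
begin

lemma exponent_bounds: "s * (real (n N))\<^sup>2 \<le> real (m N)" "real (m N) \<le> s * (real (n N))\<^sup>2 + 1"
proof -
  have "0 \<le> \<lceil>s * (real (n N))\<^sup>2\<rceil>"
    using s by (simp add: ceiling_le_zero order_less_le_trans[of "-1" 0])
  then have "real (m N) = of_int \<lceil>s * (real (n N))\<^sup>2\<rceil>"
    by (simp add: m_def)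
  then show "s * (real (n N))\<^sup>2 \<le> real (m N)" "real (m N) \<le> s * (real (n N))\<^sup>2 + 1"
    by linarith+
qed

lemma exponent_ratio: "(\<lambda>N. real (m N) / (real (n N))\<^sup>2) \<longlonglongrightarrow> s"
proof (rule real_tendsto_sandwich)
  have npos: "(real (n N))\<^sup>2 > 0" for N
    by (simp add: n_def)
  show "\<forall>\<^sub>F N in sequentially. s \<le> real (m N) / (real (n N))\<^sup>2"
    using exponent_bounds(1) npos by (simp add: pos_le_divide_eq)
  show "\<forall>\<^sub>F N in sequentially. real (m N) / (real (n N))\<^sup>2 \<le> s + 1 / (real (n N))\<^sup>2"
  proof (intro always_eventually allI)
    fix N
    have "real (m N) / (real (n N))\<^sup>2 \<le> (s * (real (n N))\<^sup>2 + 1) / (real (n N))\<^sup>2"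
      by (intro divide_right_mono exponent_bounds) simp
    also have "\<dots> = s + 1 / (real (n N))\<^sup>2"
      using npos[of N] by (simp add: add_divide_distrib)
    finally show "real (m N) / (real (n N))\<^sup>2 \<le> s + 1 / (real (n N))\<^sup>2" .
  qed
  show "(\<lambda>N. s + 1 / (real (n N))\<^sup>2) \<longlonglongrightarrow> s"
    unfolding n_def by real_asymp
qed auto

lemma exponent_at_top: "filterlim m at_top sequentially"
proof -
  have "filterlim (\<lambda>N. s * (real (n N))\<^sup>2) at_top sequentially"
    unfolding n_def using s by real_asymp
  then have "filterlim (\<lambda>N. real (m N)) at_top sequentially"
    by (rule filterlim_at_top_mono) (simp add: exponent_bounds)
  then show ?thesis
    by (simp add: filterlim_sequentially_iff_filterlim_real)
qed

text \<open>Since ln cos x behaves like -x^2 / 2 near 0 and \<open>m / n\<^sup>2\<close> tends to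
  \<open>s\<close>, the summand for \<open>l\<close> tends to exp(-pi^2 s l^2). Rounding
  \<open>m\<close> upwards gives \<open>m \<ge> s * n\<^sup>2\<close>, so this limit is itself a
  majorant by \<open>cos_le_exp\<close>.\<close>

lemma cos_side:
  "(\<lambda>N. \<Sum>l=-int N..int N. cos (pi * of_int l / real (n N)) ^ (2 * m N)) \<longlonglongrightarrow> gauss_theta (pi\<^sup>2 * s)"
proof -
  define f where "f N l = (if l \<in> {-int N..int N} then cos (pi * of_int l / real (n N)) ^ (2 * m N) else 0)"
    for N and l :: int
  have "(\<lambda>N. \<Sum>l=-int N..int N. cos (pi * of_int l / real (n N)) ^ (2 * m N))
      \<longlonglongrightarrow> (\<Sum>\<^sub>\<infinity>l\<in>UNIV. exp (- (pi\<^sup>2 * s) * (of_int l)\<^sup>2))"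
  proof (rule tannery_has_sum[where N = 0])
    show "(f N has_sum (\<Sum>l=-int N..int N. cos (pi * of_int l / real (n N)) ^ (2 * m N))) UNIV" for N
      by (intro has_sum_finite_neutralI[of "{-int N..int N}"]) (auto simp: f_def)
    show "(\<lambda>l::int. exp (- (pi\<^sup>2 * s) * (of_int l)\<^sup>2)) summable_on UNIV"
      using s by (intro has_sum_imp_summable[OF has_sum_gauss_theta]) auto
    show "norm (f N l) \<le> exp (- (pi\<^sup>2 * s) * (of_int l)\<^sup>2)" for N l
    proof (cases "l \<in> {-int N..int N}")
      case True
      define x where "x = pi * of_int l / real (n N)"
      have "\<bar>of_int l\<bar> \<le> real N"
        using True by auto
      then have "\<bar>of_int l\<bar> / real (n N) \<le> 1 / 2"
        by (simp add: n_def field_simps)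
      then have "pi * (\<bar>of_int l\<bar> / real (n N)) \<le> pi * (1 / 2)"
        by (intro mult_left_mono) auto
      then have "\<bar>x\<bar> \<le> pi / 2"
        by (simp add: x_def abs_mult)
      then have "norm (f N l) \<le> exp (- x\<^sup>2 / 2) ^ (2 * m N)"
        unfolding f_def x_def[symmetric] using True cos_le_exp[of x]
        by (auto simp: power_abs intro!: power_mono)
      also have "\<dots> = exp (- (x\<^sup>2 * real (m N)))"
        by (simp flip: exp_of_nat_mult)
      also have "\<dots> \<le> exp (- (x\<^sup>2 * (s * (real (n N))\<^sup>2)))"
        using exponent_bounds(1)[of N] by (simp add: mult_left_mono)
      also have "x\<^sup>2 * (s * (real (n N))\<^sup>2) = pi\<^sup>2 * s * (of_int l)\<^sup>2"
        by (simp add: x_def n_def power_divide power_mult_distrib)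
      finally show ?thesis
        by simp
    qed (auto simp: f_def)
    show "(\<lambda>N. f N l) \<longlonglongrightarrow> exp (- (pi\<^sup>2 * s) * (of_int l)\<^sup>2)" for l
    proof -
      define a where "a = pi * real_of_int l"
      have "(\<lambda>N. 2 * (real (n N))\<^sup>2 * ln (cos (a / real (n N)))) \<longlonglongrightarrow> - (a * a)"
        unfolding n_def by real_asymp
      then have "(\<lambda>N. exp ((real (m N) / (real (n N))\<^sup>2) * (2 * (real (n N))\<^sup>2 * ln (cos (a / real (n N))))))
          \<longlonglongrightarrow> exp (s * (- (a * a)))"
        by (intro tendsto_intros exponent_ratio)
      moreover have "(\<lambda>N. cos (a / real (n N))) \<longlonglongrightarrow> 1"
        unfolding n_def by real_asymp
      then have "\<forall>\<^sub>F N in sequentially. cos (a / real (n N)) > 0"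
        by (rule order_tendstoD) simp
      then have "\<forall>\<^sub>F N in sequentially. exp ((real (m N) / (real (n N))\<^sup>2) *
          (2 * (real (n N))\<^sup>2 * ln (cos (a / real (n N))))) = f N l"
        using eventually_ge_at_top[of "nat \<bar>l\<bar>"]
      proof eventually_elim
        case (elim N)
        have "(real (m N) / (real (n N))\<^sup>2) * (2 * (real (n N))\<^sup>2 * ln (cos (a / real (n N)))) =
            real (2 * m N) * ln (cos (a / real (n N)))"
          by (simp add: n_def)
        then have "exp ((real (m N) / (real (n N))\<^sup>2) * (2 * (real (n N))\<^sup>2 * ln (cos (a / real (n N))))) =
            cos (a / real (n N)) ^ (2 * m N)"
          using elim(1) by (simp only: exp_of_nat_mult exp_ln)
        then show ?case
          using elim(2) by (auto simp: f_def a_def)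
      qed
      ultimately have "(\<lambda>N. f N l) \<longlonglongrightarrow> exp (s * (- (a * a)))"
        by (rule Lim_transform_eventually)
      then show ?thesis
        by (simp add: a_def power2_eq_square mult_ac)
    qed
  qed
  then show ?thesis
    using infsumI[OF has_sum_gauss_theta[of "pi\<^sup>2 * s"]] s by simp
qed

text \<open>The normalised coefficient at distance k = |j| n from the centre is about exp(-k^2 / m),
  and k^2 / m tends to j^2 / s; \<open>central_ratio_bounds\<close> makes this a two-sided
  estimate.\<close>

lemma binomial_side:
  "(\<lambda>N. (\<Sum>\<^sub>\<infinity>j\<in>UNIV. central_binom (m N) (j * int (n N)) / central_binom (m N) 0)) \<longlonglongrightarrow> gauss_theta (1 / s)"
proof -
  define f where "f N j = central_binom (m N) (j * int (n N)) / central_binom (m N) 0" for N and j :: int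
  have f_eq: "f N j = real ((2 * m N) choose (m N + nat \<bar>j\<bar> * n N)) / real ((2 * m N) choose (m N))"
    if "nat \<bar>j\<bar> * n N \<le> m N" for N j
    using that by (simp add: f_def central_binom_nat abs_mult nat_mult_distrib)
  have f_0: "f N j = 0" if "\<not> nat \<bar>j\<bar> * n N \<le> m N" for N j
    using that by (simp add: f_def central_binom_nat abs_mult nat_mult_distrib)
  have nz: "n N \<noteq> 0" for N
    by (simp add: n_def)
  have pos: "real ((2 * m N) choose (m N)) > 0" for N
    by simp
  \<comment> \<open>For nonzero terms k <= m and m <= (s + 1) n^2, so the denominator m + k of the
    upper bound is at most 2 (s + 1) n^2.\<close>
  define c where "c = 1 / (2 * (s + 1))"
  have c: "c > 0"
    using s by (simp add: c_def)
  have bound: "norm (f N j) \<le> exp (- c * (of_int j)\<^sup>2)" for N j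
  proof (cases "nat \<bar>j\<bar> * n N \<le> m N")
    case True
    define k where "k = nat \<bar>j\<bar> * n N"
    have npos: "(real (n N))\<^sup>2 \<ge> 1"
      by (simp add: n_def)
    have "real (m N) \<le> (s + 1) * (real (n N))\<^sup>2"
      using exponent_bounds(2)[of N] npos by (simp add: distrib_right)
    then have m: "real (m N) + real k \<le> 2 * (s + 1) * (real (n N))\<^sup>2"
    proof -
      have "real k \<le> real (m N)"
        unfolding k_def using True by (simp only: of_nat_le_iff)
      then show ?thesis
        using \<open>real (m N) \<le> (s + 1) * (real (n N))\<^sup>2\<close> by (simp add: algebra_simps)
    qed
    show ?thesis
    proof (cases "m N = 0")
      case True
      then have "j = 0"
        using \<open>nat \<bar>j\<bar> * n N \<le> m N\<close> by (simp add: n_def)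
      then show ?thesis
        using True by (simp add: f_def central_binom_nat)
    next
      case False
      have "norm (f N j) = real ((2 * m N) choose (m N + k)) / real ((2 * m N) choose (m N))"
        using f_eq[OF True] by (simp add: k_def)
      also have "\<dots> \<le> exp (- (real k)\<^sup>2 / (real (m N) + real k))"
        using central_ratio_bounds(1)[of k "m N"] True pos[of N]
        by (simp add: k_def pos_divide_le_eq mult.commute)
      also have "\<dots> \<le> exp (- (real k)\<^sup>2 / (2 * (s + 1) * (real (n N))\<^sup>2))"
        using m False s npos by (auto intro!: divide_left_mono mult_pos_pos simp: n_def)
      also have "- (real k)\<^sup>2 / (2 * (s + 1) * (real (n N))\<^sup>2) = - c * (of_int j)\<^sup>2"
        using nz[of N] by (simp add: k_def c_def power_mult_distrib)
      finally show ?thesis .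
    qed
  qed (simp add: f_0)
  have lim: "(\<lambda>N. f N j) \<longlonglongrightarrow> exp (- (1 / s) * (of_int j)\<^sup>2)" for j
  proof -
    define k where "k N = nat \<bar>j\<bar> * n N" for N
    \<comment> \<open>The pair d = 1, e = -1 gives the denominator of the lower bound, and d = 0, e
      = 1 that of the upper bound.\<close>
    have ratio: "(\<lambda>N. real (m N) / (real (n N))\<^sup>2 + d / (real (n N))\<^sup>2 + e * (real (k N) / (real (n N))\<^sup>2)) \<longlonglongrightarrow> s" for d e
    proof -
      have "(\<lambda>N. d / (real (n N))\<^sup>2) \<longlonglongrightarrow> 0" "(\<lambda>N. real (k N) / (real (n N))\<^sup>2) \<longlonglongrightarrow> 0"
        unfolding k_def n_def of_nat_mult by real_asymp+
      then have "(\<lambda>N. real (m N) / (real (n N))\<^sup>2 + d / (real (n N))\<^sup>2 + e * (real (k N) / (real (n N))\<^sup>2)) \<longlonglongrightarrow> s + 0 + e * 0"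
        by (intro tendsto_intros exponent_ratio)
      then show ?thesis
        by simp
    qed
    have lim_exp: "(\<lambda>N. exp (- (real (k N))\<^sup>2 / (real (m N) + d + e * real (k N)))) \<longlonglongrightarrow> exp (- (1 / s) * (of_int j)\<^sup>2)" for d e
    proof -
      have "(\<lambda>N. exp (- ((of_int j)\<^sup>2 / (real (m N) / (real (n N))\<^sup>2 + d / (real (n N))\<^sup>2 + e * (real (k N) / (real (n N))\<^sup>2)))))
          \<longlonglongrightarrow> exp (- ((of_int j)\<^sup>2 / s))"
        using s by (intro tendsto_intros ratio) auto
      moreover have "(of_int j)\<^sup>2 / (real (m N) / (real (n N))\<^sup>2 + d / (real (n N))\<^sup>2 + e * (real (k N) / (real (n N))\<^sup>2)) =
          (real (k N))\<^sup>2 / (real (m N) + d + e * real (k N))" for N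
      proof -
        have "real (m N) / (real (n N))\<^sup>2 + d / (real (n N))\<^sup>2 + e * (real (k N) / (real (n N))\<^sup>2) =
            (real (m N) + d + e * real (k N)) / (real (n N))\<^sup>2"
          by (simp add: add_divide_distrib)
        then show ?thesis
          using nz[of N] by (simp add: k_def power_mult_distrib)
      qed
      ultimately show ?thesis
        by simp
    qed
    have "(\<lambda>N. real (m N) / (real (n N))\<^sup>2 + 0 / (real (n N))\<^sup>2 + (- 1) * (real (k N) / (real (n N))\<^sup>2)) \<longlonglongrightarrow> s"
      by (rule ratio)
    then have "\<forall>\<^sub>F N in sequentially. real (m N) / (real (n N))\<^sup>2 + 0 / (real (n N))\<^sup>2 + (- 1) * (real (k N) / (real (n N))\<^sup>2) > 0"
      using s by (rule order_tendstoD)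
    then have le: "\<forall>\<^sub>F N in sequentially. k N \<le> m N"
    proof eventually_elim
      case (elim N)
      then have "real (k N) / (real (n N))\<^sup>2 < real (m N) / (real (n N))\<^sup>2"
        by simp
      then show ?case
        by (simp add: divide_less_cancel n_def)
    qed
    show ?thesis
    proof (rule real_tendsto_sandwich)
      show "\<forall>\<^sub>F N in sequentially. exp (- (real (k N))\<^sup>2 / (real (m N) + 1 + (- 1) * real (k N))) \<le> f N j"
        using le
      proof eventually_elim
        case (elim N)
        then show ?case
          using central_ratio_bounds(2)[OF elim] pos[of N] f_eq[of j N]
          by (simp add: k_def pos_le_divide_eq mult.commute)
      qed
      show "\<forall>\<^sub>F N in sequentially. f N j \<le> exp (- (real (k N))\<^sup>2 / (real (m N) + 0 + 1 * real (k N)))"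
        using le
      proof eventually_elim
        case (elim N)
        then show ?case
          using central_ratio_bounds(1)[OF elim] pos[of N] f_eq[of j N]
          by (simp add: k_def pos_divide_le_eq mult.commute)
      qed
    qed (rule lim_exp)+
  qed
  have "(\<lambda>N. (\<Sum>\<^sub>\<infinity>j\<in>UNIV. f N j)) \<longlonglongrightarrow> (\<Sum>\<^sub>\<infinity>j\<in>UNIV. exp (- (1 / s) * (of_int j)\<^sup>2))"
  proof (rule tannery_has_sum[where N = 0])
    show summable: "(\<lambda>j::int. exp (- c * (of_int j)\<^sup>2)) summable_on UNIV"
      by (rule has_sum_imp_summable[OF has_sum_gauss_theta[OF c]])
    show "(f N has_sum (\<Sum>\<^sub>\<infinity>j\<in>UNIV. f N j)) UNIV" for N
      by (intro has_sum_infsum abs_summable_summable[OF Infinite_Sum.abs_summable_on_comparison_test'[OF summable]] bound)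
  qed (rule bound lim)+
  then show ?thesis
    using infsumI[OF has_sum_gauss_theta[of "1 / s"]] s by (simp add: f_def)
qed

text \<open>Dividing \<open>polya_identity\<close> by \<open>4 ^ m\<close> and by the central
  coefficient shows that the quotient of the sums in \<open>cos_side\<close> and
  \<open>binomial_side\<close> equals the left sequence as soon as the denominator is
  positive.\<close>

lemma theta_ratio_limit:
  "(\<lambda>N. real (n N) * (central_binom (m N) 0 / 4 ^ m N)) \<longlonglongrightarrow> gauss_theta (pi\<^sup>2 * s) / gauss_theta (1 / s)"
proof -
  have "gauss_theta (1 / s) \<noteq> 0"
    using gauss_theta_pos[of "1 / s"] s by simp
  then have "(\<lambda>N. (\<Sum>l=-int N..int N. cos (pi * of_int l / real (n N)) ^ (2 * m N)) /
      (\<Sum>\<^sub>\<infinity>j\<in>UNIV. central_binom (m N) (j * int (n N)) / central_binom (m N) 0))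
      \<longlonglongrightarrow> gauss_theta (pi\<^sup>2 * s) / gauss_theta (1 / s)"
    by (intro tendsto_divide cos_side binomial_side)
  moreover have "\<forall>\<^sub>F N in sequentially.
    (\<Sum>l=-int N..int N. cos (pi * of_int l / real (n N)) ^ (2 * m N)) /
      (\<Sum>\<^sub>\<infinity>j\<in>UNIV. central_binom (m N) (j * int (n N)) / central_binom (m N) 0) =
    real (n N) * (central_binom (m N) 0 / 4 ^ m N)"
  proof -
    have "\<forall>\<^sub>F N in sequentially. (\<Sum>\<^sub>\<infinity>j\<in>UNIV. central_binom (m N) (j * int (n N)) / central_binom (m N) 0) > 0"
      using gauss_theta_pos[of "1 / s"] s by (intro order_tendstoD[OF binomial_side]) simp
    then show ?thesis
    proof eventually_elim
      case (elim N)
      define R where "R = (\<Sum>\<^sub>\<infinity>j\<in>UNIV. central_binom (m N) (j * int (n N)) / central_binom (m N) 0)"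
      have nz: "central_binom (m N) 0 \<noteq> 0"
        by (simp add: central_binom_def)
      have "real (n N) * central_binom (m N) 0 * R =
          (\<Sum>\<^sub>\<infinity>j\<in>UNIV. real (n N) * central_binom (m N) 0 * (central_binom (m N) (j * int (n N)) / central_binom (m N) 0))"
        unfolding R_def by (rule infsum_cmult_right'[symmetric])
      also have "\<dots> = (\<Sum>\<^sub>\<infinity>j\<in>UNIV. real (n N) * central_binom (m N) (j * int (n N)))"
        using nz by simp
      also have "\<dots> = (\<Sum>l=-int N..int N. (2 * cos (pi * of_int l / real (n N))) ^ (2 * m N))"
        by (intro infsumI polya_identity) (simp add: n_def)
      also have "\<dots> = 4 ^ m N * (\<Sum>l=-int N..int N. cos (pi * of_int l / real (n N)) ^ (2 * m N))"
        by (simp add: power_mult_distrib sum_distrib_left power_mult)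
      finally show ?case
        using elim unfolding R_def[symmetric] by (simp add: field_simps)
    qed
  qed
  ultimately show ?thesis
    by (rule Lim_transform_eventually)
qed

text \<open>Writing n as sqrt m divided by sqrt (m / n^2) separates the central binomial limit
  \<open>L\<close> from the limit \<open>sqrt s\<close>.\<close>

lemma theta_ratio:
  assumes L: "(\<lambda>m. sqrt m * (real ((2 * m) choose m) / 4 ^ m)) \<longlonglongrightarrow> L"
  shows "gauss_theta (pi\<^sup>2 * s) / gauss_theta (1 / s) = L / sqrt s"
proof (rule LIMSEQ_unique[OF theta_ratio_limit])
  have "(\<lambda>N. sqrt (m N) * (real ((2 * m N) choose m N) / 4 ^ m N)) \<longlonglongrightarrow> L"
    by (rule filterlim_compose[OF L exponent_at_top])
  moreover have "(\<lambda>N. sqrt (real (m N) / (real (n N))\<^sup>2)) \<longlonglongrightarrow> sqrt s"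
    by (intro tendsto_real_sqrt exponent_ratio)
  ultimately have "(\<lambda>N. sqrt (m N) * (real ((2 * m N) choose m N) / 4 ^ m N) / sqrt (real (m N) / (real (n N))\<^sup>2)) \<longlonglongrightarrow> L / sqrt s"
    using s by (intro tendsto_divide) auto
  moreover have "sqrt (m N) * (real ((2 * m N) choose m N) / 4 ^ m N) / sqrt (real (m N) / (real (n N))\<^sup>2) =
      real (n N) * (central_binom (m N) 0 / 4 ^ m N)" for N
  proof -
    have "real (m N) > 0"
    proof (rule order_less_le_trans[OF _ exponent_bounds(1)])
      show "0 < s * (real (n N))\<^sup>2"
        using s by (simp add: n_def)
    qed
    then show ?thesis
      by (simp add: central_binom_def real_sqrt_divide)
  qed
  ultimately show "(\<lambda>N. real (n N) * (central_binom (m N) 0 / 4 ^ m N)) \<longlonglongrightarrow> L / sqrt s"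
    by simp
qed

end

text \<open>
  The limit \<open>L\<close> of the central binomial coefficients need not be computed: at \<open>s = 1 / \<pi>\<close> both theta
  values agree, which forces \<open>L = 1 / \<surd>\<pi>\<close>.
\<close>

theorem theta_inversion:
  assumes "t > 0"
  shows "gauss_theta (pi / t) = sqrt t * gauss_theta (pi * t)"
proof -
  obtain L where L: "(\<lambda>m. sqrt m * (real ((2 * m) choose m) / 4 ^ m)) \<longlonglongrightarrow> L"
    using convergent_central_binomial by (auto simp: convergent_def)
  have "gauss_theta pi \<noteq> 0"
    using gauss_theta_pos[of pi] by simp
  moreover have "pi\<^sup>2 * (1 / pi) = pi" "1 / (1 / pi) = pi" "0 < 1 / pi"
    by (simp_all add: power2_eq_square)
  ultimately have "1 = L / sqrt (1 / pi)"
    using theta_ratio[OF _ L, of "1 / pi"] by (simp only: divide_self simp_thms)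
  moreover have nz: "sqrt (1 / pi) \<noteq> 0"
    by simp
  ultimately have "L = sqrt (1 / pi)"
    by (simp only: nonzero_eq_divide_eq[OF nz] mult_1_left)
  then have "L = 1 / sqrt pi"
    by (simp add: real_sqrt_divide)
  moreover have "gauss_theta (pi / t) > 0"
    using assms by (intro gauss_theta_pos) simp
  ultimately show ?thesis
    using theta_ratio[OF _ L, of "t / pi"] assms
    by (simp add: power2_eq_square real_sqrt_divide field_simps)
qed

section \<open>Identities of level five\<close>

lemma has_sum_product_nonneg:
  fixes f g :: "'i \<Rightarrow> real"
  assumes f: "(f has_sum a) A" and g: "(g has_sum b) B"
    and nonneg: "\<And>x. x \<in> A \<Longrightarrow> 0 \<le> f x" "\<And>y. y \<in> B \<Longrightarrow> 0 \<le> g y"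
  shows "((\<lambda>(x, y). f x * g y) has_sum a * b) (A \<times> B)"
proof (rule has_sum_SigmaI[where g = "\<lambda>x. f x * b"])
  show row: "((\<lambda>y. case (x, y) of (x, y) \<Rightarrow> f x * g y) has_sum f x * b) B" if "x \<in> A" for x
    by (simp add: has_sum_cmult_right[OF g])
  show col: "((\<lambda>x. f x * b) has_sum a * b) A"
    by (rule has_sum_cmult_left[OF f])
  show "(\<lambda>(x, y). f x * g y) summable_on (SIGMA x:A. B)"
    by (rule summable_on_SigmaI[OF row has_sum_imp_summable[OF col]]) (auto simp: nonneg)
qed

lemma lattice_has_sum:
  fixes q z w :: real
  assumes "0 < q" "q < 1" "0 < z" "0 < w"
  shows "((\<lambda>(i, j). q powi i\<^sup>2 * z powi i * (q powi j\<^sup>2 * w powi j)) has_sum jtheta q z * jtheta q w) UNIV"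
proof -
  have "((\<lambda>(i, j). q powi i\<^sup>2 * z powi i * (q powi j\<^sup>2 * w powi j)) has_sum jtheta q z * jtheta q w) (UNIV \<times> UNIV)"
    by (rule has_sum_product_nonneg) (use assms in \<open>auto intro!: has_sum_jtheta\<close>)
  then show ?thesis
    by simp
qed

text \<open>The map is z -> (2 - i) z + r on Gaussian integers. Its inverse multiplies by the
  conjugate 2 + i and divides by 5; for the given \<open>r\<close> the offsets 2r and r are below 5,
  so integer division absorbs them.\<close>

lemma bij_betw_gaussian_residue:
  fixes r :: int
  assumes r: "r = 0 \<or> r = 1"
  shows "bij_betw (\<lambda>(i, j). (2 * i + j + r, 2 * j - i)) UNIV {(a, b). (a + 2 * b) mod 5 = r}"
proof (rule bij_betw_byWitness[where f' = "\<lambda>(a, b). ((2 * a - b) div 5, (a + 2 * b) div 5)"])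
  have *: "(2 * (2 * i + j + r) - (2 * j - i)) div 5 = i" "(2 * i + j + r + 2 * (2 * j - i)) div 5 = j"
    "(2 * i + j + r + 2 * (2 * j - i)) mod 5 = r" for i j
  proof -
    have "2 * (2 * i + j + r) - (2 * j - i) = 2 * r + i * 5" "2 * i + j + r + 2 * (2 * j - i) = r + j * 5"
      by simp_all
    then show "(2 * (2 * i + j + r) - (2 * j - i)) div 5 = i" "(2 * i + j + r + 2 * (2 * j - i)) div 5 = j"
      "(2 * i + j + r + 2 * (2 * j - i)) mod 5 = r"
      using r by (simp_all only: div_mult_self1 mod_mult_self1) auto
  qed
  then show "\<forall>ij\<in>UNIV. (case case ij of (i, j) \<Rightarrow> (2 * i + j + r, 2 * j - i) of
      (a, b) \<Rightarrow> ((2 * a - b) div 5, (a + 2 * b) div 5)) = ij"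
    by (simp only: Ball_def split_paired_All prod.case simp_thms)
  show "(\<lambda>(i, j). (2 * i + j + r, 2 * j - i)) ` UNIV \<subseteq> {(a, b). (a + 2 * b) mod 5 = r}"
    using * by (simp only: image_subset_iff Ball_def split_paired_All prod.case mem_Collect_eq simp_thms)
  have "(case case (a, b) of (a, b) \<Rightarrow> ((2 * a - b) div 5, (a + 2 * b) div 5) of
      (i, j) \<Rightarrow> (2 * i + j + r, 2 * j - i)) = (a, b)" if "(a + 2 * b) mod 5 = r" for a b
  proof -
    define k where "k = (a + 2 * b) div 5"
    have k: "a = 5 * k + r - 2 * b"
      using that div_mult_mod_eq[of "a + 2 * b" 5] by (simp add: k_def)
    then have "2 * a - b = 2 * r + (2 * k - b) * 5"
      by simp
    then have "(2 * a - b) div 5 = 2 * k - b"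
      using r by (simp only: div_mult_self1) auto
    then show ?thesis
      unfolding prod.case k_def[symmetric] using k by simp
  qed
  then show "\<forall>ab\<in>{(a, b). (a + 2 * b) mod 5 = r}. (case case ab of (a, b) \<Rightarrow> ((2 * a - b) div 5, (a + 2 * b) div 5) of
      (i, j) \<Rightarrow> (2 * i + j + r, 2 * j - i)) = ab"
    by blast
qed simp

text \<open>
  Writing \<open>P\<close> to the norm over the Gaussian integers, the classes modulo \<open>2 - i\<close> are
  indexed by \<open>a + 2 b\<close> modulo \<open>5\<close>; the class of \<open>0\<close> contributes \<open>\<phi>(P\<^sup>5)\<^sup>2\<close>, and the four others are
  permuted by the units, so they contribute equally.
\<close>

lemma phi_square_diff:
  fixes P :: real
  assumes P: "0 < P" "P < 1"
  shows "(ramanujan_phi P)\<^sup>2 =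
    (ramanujan_phi (P ^ 5))\<^sup>2 + 4 * (P * (jtheta (P ^ 5) (P ^ 4) * jtheta (P ^ 5) (P ^ 2)))"
proof -
  define h :: "int \<times> int \<Rightarrow> real" where "h = (\<lambda>(a, b). P powi (a\<^sup>2 + b\<^sup>2))"
  define S :: "int \<Rightarrow> (int \<times> int) set" where "S r = {(a, b). (a + 2 * b) mod 5 = r}" for r
  define X where "X = P * (jtheta (P ^ 5) (P ^ 4) * jtheta (P ^ 5) (P ^ 2))"
  have P5: "0 < P ^ 5" "P ^ 5 < 1"
    using P by (simp_all add: power_less_one_iff[of P 5])
  have powi5: "(P ^ k) powi i = P powi (int k * i)" for k i
    by (rule power_int_power)
  have total: "(h has_sum (ramanujan_phi P)\<^sup>2) UNIV"
    using lattice_has_sum[OF P, of 1 1] P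
    by (simp add: h_def ramanujan_phi_eq_jtheta power_int_add power2_eq_square[of "jtheta P 1"])
  have S0: "(h has_sum (ramanujan_phi (P ^ 5))\<^sup>2) (S 0)"
  proof -
    have "((\<lambda>(c, d). P powi (5 * c\<^sup>2 + 5 * d\<^sup>2)) has_sum (ramanujan_phi (P ^ 5))\<^sup>2) UNIV"
      using lattice_has_sum[OF P5, of 1 1] P
      by (simp add: ramanujan_phi_eq_jtheta power_int_add powi5 power2_eq_square[of "jtheta (P ^ 5) 1"])
    also have "(\<lambda>(c, d). P powi (5 * c\<^sup>2 + 5 * d\<^sup>2)) = (\<lambda>x. h ((\<lambda>(i, j). (2 * i + j + 0, 2 * j - i)) x))"
    proof (intro ext, clarsimp simp: h_def)
      fix c d :: int
      have "5 * c\<^sup>2 + 5 * d\<^sup>2 = (2 * c + d)\<^sup>2 + (2 * d - c)\<^sup>2"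
        by (simp add: power2_eq_square algebra_simps)
      then show "P powi (5 * c\<^sup>2 + 5 * d\<^sup>2) = P powi ((2 * c + d)\<^sup>2 + (2 * d - c)\<^sup>2)"
        by simp
    qed
    finally show ?thesis
      unfolding S_def by (subst (asm) has_sum_reindex_bij_betw[OF bij_betw_gaussian_residue]) auto
  qed
  have S1: "(h has_sum X) (S 1)"
  proof -
    have "((\<lambda>ij. P * (case ij of (i, j) \<Rightarrow> (P ^ 5) powi i\<^sup>2 * (P ^ 4) powi i * ((P ^ 5) powi j\<^sup>2 * (P ^ 2) powi j))) has_sum X) UNIV"
      unfolding X_def using P by (intro has_sum_cmult_right lattice_has_sum P5) auto
    also have "(\<lambda>ij. P * (case ij of (i, j) \<Rightarrow> (P ^ 5) powi i\<^sup>2 * (P ^ 4) powi i * ((P ^ 5) powi j\<^sup>2 * (P ^ 2) powi j))) =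
        (\<lambda>x. h ((\<lambda>(i, j). (2 * i + j + 1, 2 * j - i)) x))"
    proof (intro ext, clarsimp simp: h_def powi5)
      fix i j :: int
      \<comment> \<open>The norm of (2 - i) z + 1; its linear terms 4i and 2j produce the theta
        arguments \<open>P ^ 4\<close> and \<open>P ^ 2\<close>.\<close>
      have "(2 * i + j + 1)\<^sup>2 + (2 * j - i)\<^sup>2 = 1 + (5 * i\<^sup>2 + 4 * i + (5 * j\<^sup>2 + 2 * j))"
        by (simp add: power2_eq_square algebra_simps)
      then show "P * (P powi (5 * i\<^sup>2) * P powi (4 * i) * (P powi (5 * j\<^sup>2) * P powi (2 * j))) =
          P powi ((2 * i + j + 1)\<^sup>2 + (2 * j - i)\<^sup>2)"
        using P by (simp only:) (simp add: power_int_add)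
    qed
    finally show ?thesis
      unfolding S_def by (subst (asm) has_sum_reindex_bij_betw[OF bij_betw_gaussian_residue]) auto
  qed
  \<comment> \<open>Multiplication by the imaginary unit sends (a, b) to (-b, a) and doubles a + 2b
    modulo 5; its powers carry class 1 to the classes 2, 4 and 3.\<close>
  have "(h has_sum X) (S 1) \<longleftrightarrow> (h has_sum X) (S 2)"
    by (rule has_sum_reindex_bij_witness[of _ "\<lambda>(a, b). (b, - a)" "\<lambda>(a, b). (- b, a)"])
       (auto simp: S_def h_def add.commute; presburger)+
  moreover have "(h has_sum X) (S 1) \<longleftrightarrow> (h has_sum X) (S 3)"
    by (rule has_sum_reindex_bij_witness[of _ "\<lambda>(a, b). (- b, a)" "\<lambda>(a, b). (b, - a)"])
       (auto simp: S_def h_def add.commute; presburger)+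
  moreover have "(h has_sum X) (S 1) \<longleftrightarrow> (h has_sum X) (S 4)"
    by (rule has_sum_reindex_bij_witness[of _ "\<lambda>(a, b). (- a, - b)" "\<lambda>(a, b). (- a, - b)"])
       (auto simp: S_def h_def; presburger)+
  ultimately have S: "(h has_sum (if r = 0 then (ramanujan_phi (P ^ 5))\<^sup>2 else X)) (S r)"
    if "r \<in> {0, 1, 2, 3, 4}" for r
    using that S0 S1 by auto
  have "(h has_sum (\<Sum>r\<in>{0, 1, 2, 3, 4 :: int}. if r = 0 then (ramanujan_phi (P ^ 5))\<^sup>2 else X)) (\<Union>r\<in>{0, 1, 2, 3, 4}. S r)"
    by (rule sum_has_sum[OF _ S]) (auto simp: S_def)
  also have "(\<Union>r\<in>{0, 1, 2, 3, 4}. S r) = UNIV"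
  proof -
    have "(a + 2 * b) mod 5 \<in> {0, 1, 2, 3, 4}" for a b :: int
      by simp presburger
    then show ?thesis
      by (auto simp: S_def)
  qed
  finally show ?thesis
    using has_sum_unique[OF total] by (simp add: X_def)
qed

section \<open>The five-dissection of phi\<close>

text \<open>The sign \<open>e\<close> parametrises the classes of c and -c by the same
  \<open>m\<close> up to sign, so that the squares in both classes give literally the same
  series.\<close>

lemma bij_betw_signed_residue:
  fixes c e :: int
  assumes c: "0 \<le> c" "c < 5" and e: "e = 1 \<or> e = - 1"
  shows "bij_betw (\<lambda>m. e * (5 * m + c)) UNIV {n. n mod 5 = (e * c) mod 5}"
proof (rule bij_betw_byWitness[where f' = "\<lambda>n. (e * n) div 5"])
  have ee: "e * (e * x) = x" for x
    using e by auto
  show "\<forall>m\<in>UNIV. e * (e * (5 * m + c)) div 5 = m"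
    unfolding ee using c by simp
  show "(\<lambda>m. e * (5 * m + c)) ` UNIV \<subseteq> {n. n mod 5 = (e * c) mod 5}"
  proof clarify
    fix m
    have "e * (5 * m + c) = e * c + (e * m) * 5"
      by (simp add: algebra_simps)
    then show "e * (5 * m + c) mod 5 = (e * c) mod 5"
      by (simp only: mod_mult_self1)
  qed
  show "\<forall>n\<in>{n. n mod 5 = (e * c) mod 5}. e * (5 * (e * n div 5) + c) = n"
  proof clarify
    fix n :: int
    assume "n mod 5 = (e * c) mod 5"
    then have "(e * n) mod 5 = (e * (e * c)) mod 5"
      by (metis mod_mult_right_eq)
    then have "(e * n) mod 5 = c"
      unfolding ee using c by simp
    then have "5 * (e * n div 5) + c = e * n"
      using mult_div_mod_eq[of 5 "e * n"] by simp
    then show "e * (5 * (e * n div 5) + c) = n"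
      by (simp add: ee)
  qed
qed simp

text \<open>On the class of c the exponent is (5m + c)^2 = 25 m^2 + 10 c m + c^2, and the classes of
  c and -c coincide in value, hence the factors 2.\<close>

lemma phi_dissection:
  fixes q :: "'a :: {real_normed_field, banach}"
  assumes q: "norm q < 1" "q \<noteq> 0"
  shows "ramanujan_phi q =
    ramanujan_phi (q ^ 25) + 2 * q * jtheta (q ^ 25) (q ^ 10) + 2 * q ^ 4 * jtheta (q ^ 25) (q ^ 20)"
proof -
  define S :: "int \<Rightarrow> int set" where "S r = {n. n mod 5 = r}" for r
  define h where "h = (\<lambda>n::int. q powi n\<^sup>2)"
  have total: "(h has_sum ramanujan_phi q) UNIV"
    using has_sum_jtheta[of q 1] q by (simp add: h_def ramanujan_phi_eq_jtheta[symmetric])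
  have residue: "(h has_sum q ^ c\<^sup>2 * jtheta (q ^ 25) (q ^ (10 * c))) (S ((e * int c) mod 5))"
    if c: "c < 5" and e: "e = 1 \<or> e = - 1" for c :: nat and e :: int
  proof -
    have "((\<lambda>m. q ^ c\<^sup>2 * ((q ^ 25) powi m\<^sup>2 * (q ^ (10 * c)) powi m)) has_sum q ^ c\<^sup>2 * jtheta (q ^ 25) (q ^ (10 * c))) UNIV"
      using q by (intro has_sum_cmult_right has_sum_jtheta norm_power_less_one) auto
    also have "(\<lambda>m. q ^ c\<^sup>2 * ((q ^ 25) powi m\<^sup>2 * (q ^ (10 * c)) powi m)) = (\<lambda>m. h (e * (5 * m + int c)))"
    proof
      fix m :: int
      have "q ^ c\<^sup>2 * ((q ^ 25) powi m\<^sup>2 * (q ^ (10 * c)) powi m) = q powi (int (c\<^sup>2) + (25 * m\<^sup>2 + int (10 * c) * m))"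
        using q by (simp add: power_int_add power_int_power flip: of_nat_power)
      also have "int (c\<^sup>2) + (25 * m\<^sup>2 + int (10 * c) * m) = (e * (5 * m + int c))\<^sup>2"
        using e by (auto simp: power2_eq_square algebra_simps)
      finally show "q ^ c\<^sup>2 * ((q ^ 25) powi m\<^sup>2 * (q ^ (10 * c)) powi m) = h (e * (5 * m + int c))"
        by (simp add: h_def)
    qed
    finally show ?thesis
      unfolding S_def using c e by (subst (asm) has_sum_reindex_bij_betw[OF bij_betw_signed_residue]) auto
  qed
  define v where "v r = (if r = 0 then ramanujan_phi (q ^ 25) else if r = 1 \<or> r = 4
     then q * jtheta (q ^ 25) (q ^ 10) else q ^ 4 * jtheta (q ^ 25) (q ^ 20))" for r :: int
  have S: "(h has_sum v r) (S r)" if "r \<in> {0, 1, 2, 3, 4}" for r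
    using that residue[of 0 1] residue[of 1 1] residue[of 1 "-1"] residue[of 2 1] residue[of 2 "-1"]
    by (auto simp: v_def ramanujan_phi_eq_jtheta)
  have "(h has_sum (\<Sum>r\<in>{0, 1, 2, 3, 4}. v r)) (\<Union>r\<in>{0, 1, 2, 3, 4}. S r)"
    by (rule sum_has_sum[OF _ S]) (auto simp: S_def)
  also have "(\<Union>r\<in>{0, 1, 2, 3, 4}. S r) = UNIV"
  proof -
    have "n mod 5 \<in> {0, 1, 2, 3, 4}" for n :: int
      by simp presburger
    then show ?thesis
      by (auto simp: S_def)
  qed
  finally have "ramanujan_phi q = (\<Sum>r\<in>{0, 1, 2, 3, 4}. v r)"
    by (rule has_sum_unique[OF total])
  then show ?thesis
    by (simp add: v_def algebra_simps)
qed

lemma phi_eq_qpochhammer: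
  fixes q :: "'a :: {real_normed_field, banach}"
  assumes "norm q < 1" "q \<noteq> 0"
  shows "ramanujan_phi q = qpochhammer_inf (q\<^sup>2) (q\<^sup>2) * (ramanujan_chi q)\<^sup>2"
  unfolding ramanujan_phi_eq_jtheta jacobi_triple_product[OF assms one_neq_zero] ramanujan_chi_def
  by (simp add: power2_eq_square[of "qpochhammer_inf (- q) (q\<^sup>2)"])

section \<open>Norms over the fifth roots of unity\<close>

lemma sum_fifth_roots:
  fixes \<zeta> :: "'a :: field"
  assumes "\<zeta> ^ 5 = 1" "\<zeta> \<noteq> 1"
  shows "1 + \<zeta> + \<zeta> ^ 2 + \<zeta> ^ 3 + \<zeta> ^ 4 = 0"
proof -
  have "(\<zeta> - 1) * (1 + \<zeta> + \<zeta> ^ 2 + \<zeta> ^ 3 + \<zeta> ^ 4) = 0"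
    using assms(1) by algebra
  then show ?thesis
    using assms(2) by simp
qed

lemma fifth_root_power_neq_one:
  fixes \<zeta> :: "'a :: field"
  assumes "\<zeta> ^ 5 = 1" "\<zeta> \<noteq> 1" "k mod 5 \<noteq> 0"
  shows "\<zeta> ^ k \<noteq> 1"
proof -
  have "\<zeta> ^ k = \<zeta> ^ (5 * (k div 5) + k mod 5)"
    by simp
  also have "\<dots> = \<zeta> ^ (k mod 5)"
    unfolding power_add power_mult assms(1) by simp
  finally have k: "\<zeta> ^ k = \<zeta> ^ (k mod 5)" .
  have "\<zeta> ^ 2 \<noteq> 1" "\<zeta> ^ 3 \<noteq> 1" "\<zeta> ^ 4 \<noteq> 1"
    using assms(1,2) by algebra+
  moreover have "k mod 5 = 1 \<or> k mod 5 = 2 \<or> k mod 5 = 3 \<or> k mod 5 = 4"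
    using assms(3) by linarith
  ultimately show ?thesis
    using assms(2) k by auto
qed

lemma prod_fifth_roots:
  fixes \<zeta> y :: "'a :: field"
  assumes "\<zeta> ^ 5 = 1" "\<zeta> \<noteq> 1"
  shows "(\<Prod>i<5. 1 - \<zeta> ^ i * y) = 1 - y ^ 5"
proof -
  have "(\<Prod>i<5. 1 - \<zeta> ^ i * y) = (1 - y) * (1 - \<zeta> * y) * (1 - \<zeta> ^ 2 * y) * (1 - \<zeta> ^ 3 * y) * (1 - \<zeta> ^ 4 * y)"
    by (simp add: eval_nat_numeral mult_ac)
  then show ?thesis
    using sum_fifth_roots[OF assms] by algebra
qed

text \<open>Since the fourth power inverts a fifth root of unity, the factors for \<open>i\<close>
  and \<open>5 - i\<close> are conjugate. Their products involve only the Gaussian periods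
  \<open>c\<close> and \<open>d\<close>, the two roots of w^2 + w - 1.\<close>

lemma prod_fifth_roots_trinomial:
  fixes \<zeta> s t :: "'a :: field"
  assumes "\<zeta> ^ 5 = 1" "\<zeta> \<noteq> 1"
  shows "(\<Prod>i<5. 1 + \<zeta> ^ i * s + (\<zeta> ^ i) ^ 4 * t) = 1 - 5 * (s * t) + 5 * (s * t) ^ 2 + s ^ 5 + t ^ 5"
proof -
  define c where "c = \<zeta> + \<zeta> ^ 4"
  define d where "d = \<zeta> ^ 2 + \<zeta> ^ 3"
  have cd: "c + d = - 1" "c * d = - 1"
    using sum_fifth_roots[OF assms] assms(1) unfolding c_def d_def by algebra+
  have p8: "\<zeta> ^ 8 = \<zeta> ^ 3" "\<zeta> ^ 12 = \<zeta> ^ 2" "\<zeta> ^ 16 = \<zeta>"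
    using assms(1) by algebra+
  have 1: "(1 + \<zeta> * s + \<zeta> ^ 4 * t) * (1 + \<zeta> ^ 4 * s + \<zeta> * t) = 1 + c * (s + t) + s\<^sup>2 + t\<^sup>2 + d * (s * t)"
    using assms(1) unfolding c_def d_def by algebra
  have 2: "(1 + \<zeta> ^ 2 * s + \<zeta> ^ 3 * t) * (1 + \<zeta> ^ 3 * s + \<zeta> ^ 2 * t) = 1 + d * (s + t) + s\<^sup>2 + t\<^sup>2 + c * (s * t)"
    using assms(1) unfolding c_def d_def by algebra
  have "(\<Prod>i<5. 1 + \<zeta> ^ i * s + (\<zeta> ^ i) ^ 4 * t) =
      (1 + s + t) * (1 + \<zeta> * s + \<zeta> ^ 4 * t) * (1 + \<zeta> ^ 2 * s + \<zeta> ^ 8 * t) *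
      (1 + \<zeta> ^ 3 * s + \<zeta> ^ 12 * t) * (1 + \<zeta> ^ 4 * s + \<zeta> ^ 16 * t)"
    by (simp add: lessThan_nat_numeral power_mult[symmetric] mult_ac flip: numeral_eq_Suc)
  also have "\<dots> = (1 + s + t) * ((1 + \<zeta> * s + \<zeta> ^ 4 * t) * (1 + \<zeta> ^ 4 * s + \<zeta> * t)) *
      ((1 + \<zeta> ^ 2 * s + \<zeta> ^ 3 * t) * (1 + \<zeta> ^ 3 * s + \<zeta> ^ 2 * t))"
    unfolding p8 by (simp add: mult_ac)
  also have "\<dots> = 1 - 5 * (s * t) + 5 * (s * t) ^ 2 + s ^ 5 + t ^ 5"
    unfolding 1 2 using cd by algebra
  finally show ?thesis .
qed

lemma qpochhammer_inf_fifth_roots: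
  fixes a q \<zeta> :: "'a :: {real_normed_field, banach}"
  assumes "norm q < 1" "\<zeta> ^ 5 = 1" "\<zeta> \<noteq> 1"
  shows "(\<Prod>i<5. qpochhammer_inf (\<zeta> ^ i * a) q) = qpochhammer_inf (a ^ 5) (q ^ 5)"
proof (rule LIMSEQ_unique)
  show "(\<lambda>n. \<Prod>i<5. \<Prod>k<n. 1 - \<zeta> ^ i * a * q ^ k) \<longlonglongrightarrow> (\<Prod>i<5. qpochhammer_inf (\<zeta> ^ i * a) q)"
    using assms by (intro tendsto_prod qpochhammer_inf_tendsto)
  have "(\<Prod>i<5. \<Prod>k<n. 1 - \<zeta> ^ i * a * q ^ k) = (\<Prod>k<n. 1 - a ^ 5 * (q ^ 5) ^ k)" for n
  proof -
    have "(\<Prod>i<5. \<Prod>k<n. 1 - \<zeta> ^ i * a * q ^ k) = (\<Prod>k<n. \<Prod>i<5. 1 - \<zeta> ^ i * (a * q ^ k))"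
      by (subst prod.swap) (simp add: mult.assoc)
    also have "\<dots> = (\<Prod>k<n. 1 - a ^ 5 * (q ^ 5) ^ k)"
      unfolding prod_fifth_roots[OF assms(2,3)] by (simp add: power_mult_distrib power_mult[symmetric] mult.commute)
    finally show ?thesis .
  qed
  moreover have "(\<lambda>n. \<Prod>k<n. 1 - a ^ 5 * (q ^ 5) ^ k) \<longlonglongrightarrow> qpochhammer_inf (a ^ 5) (q ^ 5)"
    using assms by (intro qpochhammer_inf_tendsto norm_power_less_one) auto
  ultimately show "(\<lambda>n. \<Prod>i<5. \<Prod>k<n. 1 - \<zeta> ^ i * a * q ^ k) \<longlonglongrightarrow> qpochhammer_inf (a ^ 5) (q ^ 5)"
    by simp
qed

lemma norm_fifth_root:
  fixes \<zeta> :: "'a :: real_normed_div_algebra"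
  assumes "\<zeta> ^ 5 = 1"
  shows "norm \<zeta> = 1"
proof (rule power_eq_imp_eq_base)
  show "norm \<zeta> ^ 5 = 1 ^ 5"
    using assms by (metis norm_power norm_one power_one)
qed auto

text \<open>Factors are sorted by exponent modulo 10. Four classes have exponents prime to 5, and
  their norms are the corresponding classes of \<open>F (p ^ 5)\<close>. The class with exponents
  divisible by 5 does not see \<open>\<zeta>\<close> and contributes \<open>F (p ^ 5) ^ 5\<close>;
  the class missing from a sixth copy of \<open>F (p ^ 5)\<close> is exactly
  \<open>F (p ^ 25)\<close>. The condition \<open>s ^ 5 = s\<close> lets the sign survive the
  norm.\<close>

lemma qpochhammer_norm_fifth_roots:
  fixes p s \<zeta> :: "'a :: {real_normed_field, banach}" and u :: nat
  assumes p: "norm p < 1" and \<zeta>: "\<zeta> ^ 5 = 1" "\<zeta> \<noteq> 1"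
    and s: "s ^ 5 = s" and u: "u = 1 \<or> u = 2"
  defines "F \<equiv> \<lambda>q. qpochhammer_inf (s * q ^ u) (q\<^sup>2)"
  shows "F (p ^ 25) * (\<Prod>i<5. F (\<zeta> ^ i * p)) = F (p ^ 5) ^ 6"
proof -
  have split: "F q = (\<Prod>r<5. qpochhammer_inf (s * q ^ (u + 2 * r)) (q ^ 10))" if "norm q < 1" for q
  proof -
    have "norm (q\<^sup>2) < 1"
      using that by (intro norm_power_less_one) auto
    then show ?thesis
      unfolding F_def by (subst qpochhammer_inf_split[of _ 5]) (simp_all add: power_add power_mult mult.assoc flip: power_mult)
  qed
  \<comment> \<open>For r = 2u the exponent u + 2r is 5u, the only multiple of 5 among the five
    classes.\<close>
  define r0 where "r0 = 2 * u"
  have r0: "r0 < 5" "u + 2 * r0 = 5 * u"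
    using u by (auto simp: r0_def)
  have residue: "(\<Prod>i<5. qpochhammer_inf (s * (\<zeta> ^ i * p) ^ (u + 2 * r)) ((\<zeta> ^ i * p) ^ 10)) =
      (if r = r0 then F (p ^ 5) ^ 5 else qpochhammer_inf (s * (p ^ 5) ^ (u + 2 * r)) ((p ^ 5) ^ 10))"
    if "r < 5" for r
  proof -
    define \<xi> where "\<xi> = \<zeta> ^ (u + 2 * r)"
    have "(\<zeta> ^ i) ^ 10 = 1" for i
    proof -
      have "(\<zeta> ^ i) ^ 10 = (\<zeta> ^ 5) ^ (2 * i)"
        by (simp flip: power_mult add: mult.commute)
      then show ?thesis
        by (simp add: \<zeta>)
    qed
    then have *: "qpochhammer_inf (s * (\<zeta> ^ i * p) ^ (u + 2 * r)) ((\<zeta> ^ i * p) ^ 10) =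
        qpochhammer_inf (\<xi> ^ i * (s * p ^ (u + 2 * r))) (p ^ 10)" for i
      by (simp add: \<xi>_def power_mult_distrib mult_ac flip: power_mult)
    have p10: "norm (p ^ 10) < 1"
      using p by (intro norm_power_less_one) auto
    have \<xi>5: "\<xi> ^ 5 = 1"
      unfolding \<xi>_def by (metis \<zeta>(1) mult.commute power_mult power_one)
    show ?thesis
    proof (cases "r = r0")
      case True
      have "\<xi> = 1"
        unfolding \<xi>_def True r0(2) power_mult \<zeta>(1) by simp
      then show ?thesis
        unfolding * using True r0(2) by (simp add: F_def flip: power_mult)
    next
      case False
      have "(u + 2 * r) mod 5 \<noteq> 0"
        using False that u unfolding r0_def by presburger
      then have "\<xi> \<noteq> 1"
        unfolding \<xi>_def by (intro fifth_root_power_neq_one \<zeta>)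
      then show ?thesis
        unfolding * qpochhammer_inf_fifth_roots[OF p10 \<xi>5 \<open>\<xi> \<noteq> 1\<close>] using False
        by (simp add: power_mult_distrib s mult.commute flip: power_mult)
    qed
  qed
  have norms: "norm (\<zeta> ^ i * p) < 1" for i
  proof -
    show ?thesis
      using p by (simp add: norm_mult norm_power norm_fifth_root[OF \<zeta>(1)])
  qed
  define G where "G r = qpochhammer_inf (s * (p ^ 5) ^ (u + 2 * r)) ((p ^ 5) ^ 10)" for r
  have "(\<Prod>i<5. F (\<zeta> ^ i * p)) =
      (\<Prod>r<5. \<Prod>i<5. qpochhammer_inf (s * (\<zeta> ^ i * p) ^ (u + 2 * r)) ((\<zeta> ^ i * p) ^ 10))"
    unfolding split[OF norms] by (rule prod.swap)
  also have "\<dots> = (\<Prod>r<5. if r = r0 then F (p ^ 5) ^ 5 else G r)"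
    by (intro prod.cong refl) (simp add: residue G_def)
  also have "\<dots> = F (p ^ 5) ^ 5 * (\<Prod>r\<in>{..<5} - {r0}. G r)"
    using r0(1) by (subst prod.remove[of _ r0]) auto
  finally have *: "(\<Prod>i<5. F (\<zeta> ^ i * p)) = F (p ^ 5) ^ 5 * (\<Prod>r\<in>{..<5} - {r0}. G r)" .
  have "F (p ^ 25) = G r0"
    unfolding G_def r0(2) F_def by (simp flip: power_mult)
  moreover have "F (p ^ 5) = G r0 * (\<Prod>r\<in>{..<5} - {r0}. G r)"
    using r0(1) p unfolding G_def by (subst split) (auto simp: norm_power_less_one intro!: prod.remove)
  ultimately show ?thesis
    unfolding * by (simp add: power_Suc[of _ 5, symmetric] mult_ac eval_nat_numeral)
qed

lemma phi_norm_fifth_roots: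
  fixes p \<zeta> :: "'a :: {real_normed_field, banach}"
  assumes p: "norm p < 1" "p \<noteq> 0" and \<zeta>: "\<zeta> ^ 5 = 1" "\<zeta> \<noteq> 1"
  shows "ramanujan_phi (p ^ 25) * (\<Prod>i<5. ramanujan_phi (\<zeta> ^ i * p)) = ramanujan_phi (p ^ 5) ^ 6"
proof -
  \<comment> \<open>The factors \<open>1\<close>, \<open>- 1\<close> and the exponent
    \<open>1\<close> are spelled out to match the shape \<open>s * q ^ u\<close> of
    \<open>qpochhammer_norm_fifth_roots\<close>.\<close>
  define E where "E q = qpochhammer_inf (1 * q ^ 2) (q\<^sup>2)" for q :: 'a
  define X where "X q = qpochhammer_inf (- 1 * q ^ 1) (q\<^sup>2)" for q :: 'a
  have \<zeta>0: "\<zeta> \<noteq> 0"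
    using \<zeta>(1) by auto
  have norms: "norm (\<zeta> ^ i * p) < 1" for i
    using p by (simp add: norm_mult norm_power norm_fifth_root[OF \<zeta>(1)])
  have phi: "ramanujan_phi q = E q * (X q)\<^sup>2" if "norm q < 1" "q \<noteq> 0" for q
    using phi_eq_qpochhammer[OF that] by (simp add: E_def X_def ramanujan_chi_def)
  have E: "E (p ^ 25) * (\<Prod>i<5. E (\<zeta> ^ i * p)) = E (p ^ 5) ^ 6"
    unfolding E_def by (rule qpochhammer_norm_fifth_roots) (use p \<zeta> in auto)
  have X: "X (p ^ 25) * (\<Prod>i<5. X (\<zeta> ^ i * p)) = X (p ^ 5) ^ 6"
    unfolding X_def by (rule qpochhammer_norm_fifth_roots) (use p \<zeta> in auto)
  have prod: "(\<Prod>i<5. ramanujan_phi (\<zeta> ^ i * p)) = (\<Prod>i<5. E (\<zeta> ^ i * p)) * (\<Prod>i<5. X (\<zeta> ^ i * p))\<^sup>2"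
    using p \<zeta>0 by (simp add: phi[OF norms] prod.distrib prod_power_distrib)
  have phi25: "ramanujan_phi (p ^ 25) = E (p ^ 25) * (X (p ^ 25))\<^sup>2"
    using p by (intro phi norm_power_less_one) auto
  have phi5: "ramanujan_phi (p ^ 5) = E (p ^ 5) * (X (p ^ 5))\<^sup>2"
    using p by (intro phi norm_power_less_one) auto
  have "ramanujan_phi (p ^ 25) * (\<Prod>i<5. ramanujan_phi (\<zeta> ^ i * p)) =
      (E (p ^ 25) * (\<Prod>i<5. E (\<zeta> ^ i * p))) * (X (p ^ 25) * (\<Prod>i<5. X (\<zeta> ^ i * p)))\<^sup>2"
    unfolding prod phi25 power_mult_distrib by (simp only: mult_ac)
  also have "\<dots> = ramanujan_phi (p ^ 5) ^ 6"
    unfolding E X phi5 power_mult_distrib by (simp flip: power_mult)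
  finally show ?thesis .
qed

section \<open>Inversion of the class invariant\<close>

text \<open>With q = r^4 the second summand is theta_2(q), so theta_2 becomes a difference of
  phi-values, to which inversion applies. \<open>jtheta_minus_one\<close> does the same for
  theta_4.\<close>

lemma ramanujan_phi_even_odd:
  fixes r :: "'a :: {real_normed_field, banach}"
  assumes "norm r < 1" "r \<noteq> 0"
  shows "ramanujan_phi r = ramanujan_phi (r ^ 4) + r * jtheta (r ^ 4) (r ^ 4)"
proof -
  define h where "h = (\<lambda>n::int. r powi n\<^sup>2)"
  have r4: "norm (r ^ 4) < 1"
    using assms by (intro norm_power_less_one) auto
  have total: "(h has_sum ramanujan_phi r) UNIV"
    using has_sum_jtheta[of r 1] assms by (simp add: h_def ramanujan_phi_eq_jtheta[symmetric])
  have "((\<lambda>m. (r ^ 4) powi m\<^sup>2 * 1 powi m) has_sum ramanujan_phi (r ^ 4)) UNIV"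
    unfolding ramanujan_phi_eq_jtheta using r4 by (intro has_sum_jtheta) auto
  also have "(\<lambda>m. (r ^ 4) powi m\<^sup>2 * 1 powi m) = (\<lambda>m. h (2 * m))"
    by (simp add: h_def power_int_power power_mult_distrib)
  also have "((\<lambda>m. h (2 * m)) has_sum ramanujan_phi (r ^ 4)) UNIV \<longleftrightarrow>
      (h has_sum ramanujan_phi (r ^ 4)) {n. even n}"
    by (rule has_sum_reindex_bij_betw, rule bij_betw_byWitness[where f' = "\<lambda>n. n div 2"]) auto
  finally have even: "(h has_sum ramanujan_phi (r ^ 4)) {n. even n}" .
  have "((\<lambda>m. r * ((r ^ 4) powi m\<^sup>2 * (r ^ 4) powi m)) has_sum r * jtheta (r ^ 4) (r ^ 4)) UNIV"
    using r4 assms by (intro has_sum_cmult_right has_sum_jtheta) auto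
  also have "(\<lambda>m. r * ((r ^ 4) powi m\<^sup>2 * (r ^ 4) powi m)) = (\<lambda>m. h (2 * m + 1))"
  proof
    fix m :: int
    have "r * ((r ^ 4) powi m\<^sup>2 * (r ^ 4) powi m) = r powi (1 + (4 * m\<^sup>2 + 4 * m))"
      using assms by (simp add: power_int_add power_int_power)
    also have "1 + (4 * m\<^sup>2 + 4 * m) = (2 * m + 1)\<^sup>2"
      by (simp add: power2_eq_square algebra_simps)
    finally show "r * ((r ^ 4) powi m\<^sup>2 * (r ^ 4) powi m) = h (2 * m + 1)"
      by (simp add: h_def)
  qed
  also have "((\<lambda>m. h (2 * m + 1)) has_sum r * jtheta (r ^ 4) (r ^ 4)) UNIV \<longleftrightarrow>
      (h has_sum r * jtheta (r ^ 4) (r ^ 4)) {n. odd n}"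
    by (rule has_sum_reindex_bij_betw, rule bij_betw_byWitness[where f' = "\<lambda>n. n div 2"]) auto
  finally have odd: "(h has_sum r * jtheta (r ^ 4) (r ^ 4)) {n. odd n}" .
  have "(h has_sum ramanujan_phi (r ^ 4) + r * jtheta (r ^ 4) (r ^ 4)) ({n. even n} \<union> {n. odd n})"
    by (rule has_sum_Un_disjoint[OF even odd]) auto
  also have "{n. even n} \<union> {n. odd n} = (UNIV :: int set)"
    by auto
  finally show ?thesis
    by (rule has_sum_unique[OF total])
qed

lemma jtheta_minus_one:
  fixes q :: "'a :: {real_normed_field, banach}"
  assumes "norm q < 1" "q \<noteq> 0"
  shows "jtheta q (- 1) = 2 * ramanujan_phi (q ^ 4) - ramanujan_phi q"
proof -
  have q4: "norm (q ^ 4) < 1"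
    using assms by (intro norm_power_less_one) auto
  have "((\<lambda>n. q powi n\<^sup>2 * 1 powi n + q powi n\<^sup>2 * (- 1) powi n) has_sum ramanujan_phi q + jtheta q (- 1)) UNIV"
    unfolding ramanujan_phi_eq_jtheta using assms by (intro has_sum_add has_sum_jtheta) auto
  moreover have "((\<lambda>n. q powi n\<^sup>2 * 1 powi n + q powi n\<^sup>2 * (- 1) powi n) has_sum 2 * ramanujan_phi (q ^ 4)) UNIV"
  proof -
    have "((\<lambda>m. 2 * ((q ^ 4) powi m\<^sup>2 * 1 powi m)) has_sum 2 * ramanujan_phi (q ^ 4)) UNIV"
      unfolding ramanujan_phi_eq_jtheta using q4 by (intro has_sum_cmult_right has_sum_jtheta) auto
    also have "(\<lambda>m. 2 * ((q ^ 4) powi m\<^sup>2 * 1 powi m)) =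
        (\<lambda>m. (\<lambda>n. q powi n\<^sup>2 * 1 powi n + q powi n\<^sup>2 * (- 1) powi n) (2 * m))"
      by (simp add: power_int_power power_mult_distrib)
    also have "(\<dots> has_sum 2 * ramanujan_phi (q ^ 4)) UNIV \<longleftrightarrow>
        ((\<lambda>n. q powi n\<^sup>2 * 1 powi n + q powi n\<^sup>2 * (- 1) powi n) has_sum 2 * ramanujan_phi (q ^ 4)) {n. even n}"
      by (rule has_sum_reindex_bij_betw, rule bij_betw_byWitness[where f' = "\<lambda>n. n div 2"]) auto
    also have "\<dots> \<longleftrightarrow>
        ((\<lambda>n. q powi n\<^sup>2 * 1 powi n + q powi n\<^sup>2 * (- 1) powi n) has_sum 2 * ramanujan_phi (q ^ 4)) UNIV"
      by (rule has_sum_cong_neutral) auto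
    finally show ?thesis .
  qed
  ultimately have "ramanujan_phi q + jtheta q (- 1) = 2 * ramanujan_phi (q ^ 4)"
    by (rule has_sum_unique)
  then show ?thesis
    by (simp add: eq_diff_eq add.commute)
qed

text \<open>All three theta constants are triple products in \<open>E\<close>, \<open>X\<close>,
  \<open>A\<close> and \<open>B\<close>; comparing them leaves Euler's identity (-q; q) (q; q^2) =
  1, here in the form \<open>X * A * B = 1\<close>.\<close>

lemma chi_sixth_power:
  fixes q :: "'a :: {real_normed_field, banach}"
  assumes q: "norm q < 1" "q \<noteq> 0"
  shows "2 * (ramanujan_phi q)\<^sup>2 = ramanujan_chi q ^ 6 * (jtheta q q * jtheta q (- 1))"
proof -
  define E where "E = qpochhammer_inf (q\<^sup>2) (q\<^sup>2)"
  define A where "A = qpochhammer_inf (- q\<^sup>2) (q\<^sup>2)"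
  define B where "B = qpochhammer_inf q (q\<^sup>2)"
  define X where "X = ramanujan_chi q"
  have q2: "norm (q\<^sup>2) < 1"
    using q by (intro norm_power_less_one) auto
  have E0: "E \<noteq> 0"
    unfolding E_def by (rule qpochhammer_inf_nonzero[OF q2 q2])
  have minus_one: "jtheta q (- 1) = E * B\<^sup>2"
    using jacobi_triple_product[OF q, of "- 1"] unfolding E_def B_def by (simp add: power2_eq_square[of "qpochhammer_inf q (q\<^sup>2)"])
  \<comment> \<open>At z = q the triple product contains a symbol starting at -1; its leading factor
    1 + 1 splits off, and the remaining factors are those of \<open>A\<close>.\<close>
  have first: "qpochhammer_inf (- 1) (q\<^sup>2) = 2 * A"
  proof (rule LIMSEQ_unique)
    show "(\<lambda>n. \<Prod>k<Suc n. 1 - (- 1) * (q\<^sup>2) ^ k) \<longlonglongrightarrow> qpochhammer_inf (- 1) (q\<^sup>2)"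
      by (rule LIMSEQ_Suc[OF qpochhammer_inf_tendsto[OF q2]])
    have "(\<Prod>k<Suc n. 1 - (- 1) * (q\<^sup>2) ^ k) = 2 * (\<Prod>k<n. 1 - (- q\<^sup>2) * (q\<^sup>2) ^ k)" for n
      by (subst prod.lessThan_Suc_shift) (simp add: one_add_one)
    moreover have "(\<lambda>n. 2 * (\<Prod>k<n. 1 - (- q\<^sup>2) * (q\<^sup>2) ^ k)) \<longlonglongrightarrow> 2 * A"
      unfolding A_def by (intro tendsto_mult tendsto_const qpochhammer_inf_tendsto q2)
    ultimately show "(\<lambda>n. \<Prod>k<Suc n. 1 - (- 1) * (q\<^sup>2) ^ k) \<longlonglongrightarrow> 2 * A"
      by (simp only:)
  qed
  have self: "jtheta q q = E * (A * (2 * A))"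
    using jacobi_triple_product[OF q q(2)] q(2) first unfolding E_def A_def by (simp add: power2_eq_square[of q])
  have phi: "ramanujan_phi q = E * X\<^sup>2"
    using phi_eq_qpochhammer[OF q] by (simp add: E_def X_def)
  have "X * A = qpochhammer_inf (- q) q"
    using qpochhammer_inf_split[OF q(1), of 2 "- q"]
    by (simp add: A_def X_def ramanujan_chi_def numeral_2_eq_2 power2_eq_square[of q])
  moreover have "B * E = qpochhammer_inf q q"
    using qpochhammer_inf_split[OF q(1), of 2 q]
    by (simp add: B_def E_def numeral_2_eq_2 power2_eq_square[of q])
  moreover have "qpochhammer_inf q q * qpochhammer_inf (- q) q = E"
    unfolding E_def by (rule qpochhammer_inf_minus[OF q(1)])
  moreover have "E * (X * A * B) = B * E * (X * A)"
    by (simp only: mult_ac)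
  ultimately have "E * (X * A * B) = E * 1"
    by (simp only: mult_1_right)
  then have XAB: "X * A * B = 1"
    using E0 by (metis mult_left_cancel)
  have "X ^ 6 * (E * (A * (2 * A)) * (E * B\<^sup>2)) = 2 * (E * X\<^sup>2)\<^sup>2 * (X * A * B)\<^sup>2"
    by (simp add: power_mult_distrib power2_eq_square eval_nat_numeral mult_ac)
  then show ?thesis
    unfolding self minus_one phi X_def[symmetric] XAB by simp
qed

lemma ramanujan_chi_pos:
  fixes q :: real
  assumes "0 < q" "q < 1"
  shows "ramanujan_chi q > 0"
proof -
  have q2: "norm (q\<^sup>2) < 1"
    using assms by (simp add: power_less_one_iff[of q 2] abs_square_less_1)
  have "ramanujan_chi q \<ge> 0"
    unfolding ramanujan_chi_def
  proof (rule LIMSEQ_le_const[OF qpochhammer_inf_tendsto[OF q2]], intro exI allI impI prod_nonneg)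
    show "0 \<le> 1 - - q * (q\<^sup>2) ^ k" for k
      using assms by simp
  qed
  moreover have "ramanujan_chi q \<noteq> 0"
    unfolding ramanujan_chi_def using assms by (intro qpochhammer_inf_nonzero q2) auto
  ultimately show ?thesis
    by simp
qed

text \<open>The class invariant without its factor \<open>2 powr (- 1 / 4)\<close>, as a function of
  t = sqrt n on the reals; n -> 1/n becomes t -> 1/t.\<close>

definition normalized_chi :: "real \<Rightarrow> real" where
  "normalized_chi t = exp (pi * t / 24) * ramanujan_chi (exp (- pi * t))"

lemma normalized_chi_pos: "t > 0 \<Longrightarrow> normalized_chi t > 0"
  by (auto simp: normalized_chi_def intro!: mult_pos_pos ramanujan_chi_pos)

lemma class_invariant_eq:
  assumes "t = sqrt (of_rat n)"
  shows "class_invariant_G n = 2 powr (- 1 / 4) * normalized_chi t"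
  using assms by (simp add: class_invariant_G_def normalized_chi_def Let_def powr_def mult.assoc)

text \<open>A form of \<open>chi_sixth_power\<close> with phi-values only. The sixth power of the
  prefactor \<open>exp (pi * t / 24)\<close> is \<open>1 / r\<close>, which cancels the factor
  \<open>r\<close> in theta_2.\<close>

lemma normalized_chi_identity:
  assumes t: "t > 0"
  shows "2 * (gauss_theta (pi * t))\<^sup>2 = normalized_chi t ^ 6 *
    ((gauss_theta (pi * (t / 4)) - gauss_theta (pi * t)) *
     (2 * gauss_theta (pi * (4 * t)) - gauss_theta (pi * t)))"
proof -
  define r where "r = exp (- pi * t / 4)"
  define q where "q = exp (- pi * t)"
  have r4: "r ^ 4 = q" and q4: "q ^ 4 = exp (- (pi * (4 * t)))"
    by (simp_all add: r_def q_def flip: exp_of_nat_mult)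
  have q: "norm q < 1" "q \<noteq> 0" and r: "norm r < 1" "r \<noteq> 0"
    using t by (auto simp: q_def r_def)
  have th: "gauss_theta (pi * t) = ramanujan_phi q" "gauss_theta (pi * (t / 4)) = ramanujan_phi r"
      "gauss_theta (pi * (4 * t)) = ramanujan_phi (q ^ 4)"
    unfolding q4 by (simp_all add: gauss_theta_def q_def r_def)
  have "normalized_chi t ^ 6 = ramanujan_chi q ^ 6 / r"
    by (simp add: normalized_chi_def q_def r_def power_mult_distrib exp_minus field_simps flip: exp_of_nat_mult)
  moreover have "ramanujan_phi r - ramanujan_phi q = r * jtheta q q"
    using ramanujan_phi_even_odd[OF r] by (simp add: r4)
  ultimately show ?thesis
    unfolding th jtheta_minus_one[OF q, symmetric] chi_sixth_power[OF q] using r by simp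
qed

text \<open>Replacing \<open>t\<close> by \<open>1 / t\<close> interchanges the two factors in \<open>normalized_chi_identity\<close>.\<close>

lemma normalized_chi_inversion:
  assumes t: "t > 0"
  shows "normalized_chi (1 / t) = normalized_chi t"
proof -
  define h where "h u = gauss_theta (pi * u)" for u
  have inv: "h (1 / u) = sqrt u * h u" if "u > 0" for u
    using theta_inversion[OF that] by (simp add: h_def)
  define A where "A = h (t / 4) - h t"
  define B where "B = 2 * h (4 * t) - h t"
  have pos: "h t > 0"
    using t by (simp add: h_def gauss_theta_pos)
  have 1: "2 * (h t)\<^sup>2 = normalized_chi t ^ 6 * (A * B)"
    using normalized_chi_identity[OF t] by (simp add: h_def A_def B_def)
  have "2 * (h (1 / t))\<^sup>2 = normalized_chi (1 / t) ^ 6 * ((h (1 / t / 4) - h (1 / t)) * (2 * h (4 * (1 / t)) - h (1 / t)))"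
    using normalized_chi_identity[of "1 / t"] t by (simp only: h_def) simp
  moreover have "h (1 / t / 4) - h (1 / t) = sqrt t * B"
    using inv[of "4 * t"] inv[OF t] t by (simp add: B_def real_sqrt_mult algebra_simps)
  moreover have "2 * h (4 * (1 / t)) - h (1 / t) = sqrt t * A"
    using inv[of "t / 4"] inv[OF t] t by (simp add: A_def real_sqrt_divide algebra_simps)
  ultimately have "2 * (sqrt t * h t)\<^sup>2 = normalized_chi (1 / t) ^ 6 * ((sqrt t * B) * (sqrt t * A))"
    using inv[OF t] by simp
  then have "t * (2 * (h t)\<^sup>2) = t * (normalized_chi (1 / t) ^ 6 * (A * B))"
    using t by (simp add: power_mult_distrib mult_ac)
  then have 2: "2 * (h t)\<^sup>2 = normalized_chi (1 / t) ^ 6 * (A * B)"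
    using t by simp
  have "A * B \<noteq> 0"
    using 1 pos by auto
  with 1 2 have "normalized_chi (1 / t) ^ 6 = normalized_chi t ^ 6"
    by simp
  then show ?thesis
    using normalized_chi_pos[of t] normalized_chi_pos[of "1 / t"] t
    by (simp add: power_eq_iff_eq_base)
qed

section \<open>The quintic dissection\<close>

text \<open>Carries the real theta values into the complex numbers, where the fifth roots of unity
  are available, and the resulting norm identity back.\<close>

lemma jtheta_of_real:
  fixes q z :: real
  assumes "norm q < 1" "z \<noteq> 0"
  shows "jtheta (complex_of_real q) (of_real z) = of_real (jtheta q z)"
proof (rule has_sum_unique)
  show "((\<lambda>n. complex_of_real q powi n\<^sup>2 * complex_of_real z powi n) has_sum jtheta (complex_of_real q) (of_real z)) UNIV"
    using assms by (intro has_sum_jtheta) auto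
  have "((\<lambda>n. complex_of_real (q powi n\<^sup>2 * z powi n)) has_sum of_real (jtheta q z)) UNIV"
    by (intro has_sum_of_real has_sum_jtheta assms)
  then show "((\<lambda>n. complex_of_real q powi n\<^sup>2 * complex_of_real z powi n) has_sum of_real (jtheta q z)) UNIV"
    by (simp add: of_real_power_int)
qed

lemma ramanujan_phi_pos:
  fixes q :: real
  assumes "0 < q" "q < 1"
  shows "ramanujan_phi q > 0"
  using gauss_theta_pos[of "- ln q"] assms by (simp add: gauss_theta_def)

text \<open>Both parts come from \<open>phi_dissection\<close>: the first directly, the second by
  multiplying it over the arguments \<open>\<zeta> ^ i * p\<close> and comparing with
  \<open>phi_norm_fifth_roots\<close>.\<close>

lemma dissection_norm:
  fixes p :: real
  assumes p: "0 < p" "p < 1"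
  defines "A \<equiv> ramanujan_phi (p ^ 25)"
  defines "s \<equiv> 2 * p * jtheta (p ^ 25) (p ^ 10) / A"
    and "t \<equiv> 2 * p ^ 4 * jtheta (p ^ 25) (p ^ 20) / A"
  shows "ramanujan_phi p = A * (1 + s + t)"
    and "1 - 5 * (s * t) + 5 * (s * t)\<^sup>2 + s ^ 5 + t ^ 5 = (ramanujan_phi (p ^ 5) / A) ^ 6"
proof -
  have pk: "0 < p ^ k" "p ^ k < 1" if "k > 0" for k
    using p that by (auto simp: power_less_one_iff[of p k])
  have A: "A \<noteq> 0"
    unfolding A_def using ramanujan_phi_pos[OF pk(1) pk(2), of 25] by simp
  show "ramanujan_phi p = A * (1 + s + t)"
    using phi_dissection[of p] p A by (simp add: s_def t_def A_def distrib_left)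
  define \<zeta> where "\<zeta> = cis (2 * pi / 5)"
  have \<zeta>5: "\<zeta> ^ 5 = 1"
    unfolding \<zeta>_def Complex.DeMoivre by simp
  have \<zeta>1: "\<zeta> \<noteq> 1"
  proof
    assume "\<zeta> = 1"
    then have "sin (2 * pi / 5) = 0"
      by (simp add: \<zeta>_def complex_eq_iff)
    moreover have "sin (2 * pi / 5) > 0"
      by (rule sin_gt_zero) auto
    ultimately show False
      by simp
  qed
  define P where "P = complex_of_real p"
  have P: "norm P < 1" "P \<noteq> 0"
    using p by (auto simp: P_def)
  have phi: "ramanujan_phi (P ^ k) = of_real (ramanujan_phi (p ^ k))" if "k > 0" for k
    using jtheta_of_real[of "p ^ k" 1] pk[OF that] by (simp add: ramanujan_phi_eq_jtheta P_def)
  have theta: "jtheta (P ^ 25) (P ^ k) = of_real (jtheta (p ^ 25) (p ^ k))" for k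
    using jtheta_of_real[of "p ^ 25" "p ^ k"] pk[of 25] p by (simp add: P_def)
  have phi25: "ramanujan_phi (P ^ 25) = of_real A"
    by (simp add: phi A_def)
  have sA: "of_real A * of_real s = 2 * P * jtheta (P ^ 25) (P ^ 10)"
    unfolding theta unfolding P_def using A by (simp add: s_def)
  have tA: "of_real A * of_real t = 2 * P ^ 4 * jtheta (P ^ 25) (P ^ 20)"
    unfolding theta unfolding P_def using A by (simp add: t_def)
  \<comment> \<open>The exponents 25, 10 and 20 are multiples of 5, so the theta values do not
    change; only the prefactors \<open>p\<close> and \<open>p ^ 4\<close> pick up roots of
    unity.\<close>
  have each: "ramanujan_phi (\<zeta> ^ i * P) = of_real A * (1 + \<zeta> ^ i * of_real s + (\<zeta> ^ i) ^ 4 * of_real t)" for i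
  proof -
    have 5: "(\<zeta> ^ i) ^ (5 * k) = 1" for k
    proof -
      have "(\<zeta> ^ i) ^ (5 * k) = (\<zeta> ^ 5) ^ (i * k)"
        by (simp add: mult_ac flip: power_mult)
      then show ?thesis
        by (simp add: \<zeta>5)
    qed
    have "norm (\<zeta> ^ i * P) < 1" "\<zeta> ^ i * P \<noteq> 0"
      using P \<zeta>5 by (auto simp: norm_mult norm_power norm_fifth_root[OF \<zeta>5])
    from phi_dissection[OF this]
    have "ramanujan_phi (\<zeta> ^ i * P) = ramanujan_phi (P ^ 25) + 2 * (\<zeta> ^ i * P) * jtheta (P ^ 25) (P ^ 10) +
        2 * (\<zeta> ^ i * P) ^ 4 * jtheta (P ^ 25) (P ^ 20)"
      using 5[of 5] 5[of 2] 5[of 4] by (simp add: power_mult_distrib)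
    also have "\<dots> = of_real A + \<zeta> ^ i * (of_real A * of_real s) + (\<zeta> ^ i) ^ 4 * (of_real A * of_real t)"
      unfolding sA tA phi25 power_mult_distrib by (simp add: mult_ac)
    also have "\<dots> = of_real A * (1 + \<zeta> ^ i * of_real s + (\<zeta> ^ i) ^ 4 * of_real t)"
      by (simp add: algebra_simps)
    finally show ?thesis .
  qed
  have "ramanujan_phi (P ^ 25) * (\<Prod>i<5. ramanujan_phi (\<zeta> ^ i * P)) = ramanujan_phi (P ^ 5) ^ 6"
    by (rule phi_norm_fifth_roots[OF P \<zeta>5 \<zeta>1])
  also have "(\<Prod>i<5. ramanujan_phi (\<zeta> ^ i * P)) = of_real A ^ 5 *
      (1 - 5 * (of_real s * of_real t) + 5 * (of_real s * of_real t) ^ 2 + of_real s ^ 5 + of_real t ^ 5)"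
    unfolding each prod.distrib prod_fifth_roots_trinomial[OF \<zeta>5 \<zeta>1] by simp
  finally have "of_real (A * (A ^ 5 * (1 - 5 * (s * t) + 5 * (s * t)\<^sup>2 + s ^ 5 + t ^ 5))) =
      complex_of_real (ramanujan_phi (p ^ 5) ^ 6)"
    by (simp add: phi A_def)
  then have "A * (A ^ 5 * (1 - 5 * (s * t) + 5 * (s * t)\<^sup>2 + s ^ 5 + t ^ 5)) = ramanujan_phi (p ^ 5) ^ 6"
    by (simp only: of_real_eq_iff)
  then have "(1 - 5 * (s * t) + 5 * (s * t)\<^sup>2 + s ^ 5 + t ^ 5) * A ^ 6 = ramanujan_phi (p ^ 5) ^ 6"
    by (simp add: mult_ac eval_nat_numeral)
  then show "1 - 5 * (s * t) + 5 * (s * t)\<^sup>2 + s ^ 5 + t ^ 5 = (ramanujan_phi (p ^ 5) / A) ^ 6"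
    using A by (simp add: power_divide nonzero_eq_divide_eq)
qed

text \<open>The triple products contribute the exponent classes 9, 1 and 7, 3 modulo 10; together
  with the class 5, which is \<open>ramanujan_chi (P ^ 5)\<close>, they exhaust the odd residues and
  form \<open>ramanujan_chi P\<close>.\<close>

lemma theta_product_chi:
  fixes P :: real
  assumes P: "0 < P" "P < 1"
  shows "jtheta (P ^ 5) (P ^ 4) * jtheta (P ^ 5) (P ^ 2) * ramanujan_chi (P ^ 5) ^ 5 =
    ramanujan_chi P * (ramanujan_phi (P ^ 5))\<^sup>2"
proof -
  define F where "F k = qpochhammer_inf (- (P ^ k)) (P ^ 10)" for k
  define E where "E = qpochhammer_inf (P ^ 10) (P ^ 10)"
  have P5: "norm (P ^ 5) < 1" "P ^ 5 \<noteq> 0"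
    using P by (auto simp: power_less_one_iff[of P 5])
  have P2: "norm (P\<^sup>2) < 1"
    using P by (intro norm_power_less_one) auto
  have sq: "(P ^ 5)\<^sup>2 = P ^ 10"
    by (simp flip: power_mult)
  have "jtheta (P ^ 5) (P ^ 4) = E * (F 9 * F 1)"
    using jacobi_triple_product[OF P5, of "P ^ 4"] P
    unfolding sq by (simp add: E_def F_def flip: power_add power_diff)
  moreover have "jtheta (P ^ 5) (P ^ 2) = E * (F 7 * F 3)"
    using jacobi_triple_product[OF P5, of "P ^ 2"] P
    unfolding sq by (simp add: E_def F_def flip: power_add power_diff)
  moreover have chi5: "ramanujan_chi (P ^ 5) = F 5"
    unfolding ramanujan_chi_def sq F_def ..
  moreover have "ramanujan_phi (P ^ 5) = E * (F 5)\<^sup>2"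
    using phi_eq_qpochhammer[OF P5] unfolding sq chi5 E_def .
  moreover have "ramanujan_chi P = F 1 * F 3 * F 5 * F 7 * F 9"
  proof -
    have "ramanujan_chi P = (\<Prod>i<5. F (2 * i + 1))"
      unfolding ramanujan_chi_def
      by (subst qpochhammer_inf_split[OF P2, of 5]) (simp_all add: F_def flip: power_mult)
    then show ?thesis
      by (simp add: eval_nat_numeral)
  qed
  ultimately show ?thesis
    by (simp add: power2_eq_square eval_nat_numeral mult_ac)
qed

theorem theorem5p3:
  fixes n :: rat and x :: real
  assumes "n > 0"
    and "x = class_invariant_G (25 * n) / class_invariant_G n ^ 5"
  shows "ramanujan_phi (exp (- 25 * pi * sqrt (of_rat n))) /
         ramanujan_phi (exp (- pi * sqrt (of_rat n))) =
         1 / 5 * (1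
           + root 5 (x * ((2 * x - 1) ^ 2 + 7 + (4 - 2 * x) * sqrt (4 + 4 * x ^ 2)))
           + root 5 (x * ((2 * x - 1) ^ 2 + 7 - (4 - 2 * x) * sqrt (4 + 4 * x ^ 2))))"
proof -
  define \<tau> where "\<tau> = sqrt (real_of_rat n)"
  have \<tau>: "\<tau> > 0"
    using assms(1) by (simp add: \<tau>_def)
  define p where "p = exp (- pi / (25 * \<tau>))"
  define P where "P = exp (- pi / (5 * \<tau>))"
  have p: "0 < p" "p < 1" and P: "0 < P" "P < 1"
    using \<tau> by (auto simp: p_def P_def)
  have p5: "p ^ 5 = P" and p25: "p ^ 25 = exp (- (pi / \<tau>))" and P5: "P ^ 5 = p ^ 25"
    using \<tau> by (simp_all add: p_def P_def flip: exp_of_nat_mult)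
  define A where "A = ramanujan_phi (p ^ 25)"
  define s where "s = 2 * p * jtheta (p ^ 25) (p ^ 10) / A"
  define t where "t = 2 * p ^ 4 * jtheta (p ^ 25) (p ^ 20) / A"
  have A: "A > 0"
    unfolding A_def using p by (intro ramanujan_phi_pos) (auto simp: power_less_one_iff[of p 25])
  have phi_p: "ramanujan_phi p = A * (1 + s + t)"
    unfolding A_def s_def t_def by (rule dissection_norm(1)[OF p])
  have norm: "1 - 5 * (s * t) + 5 * (s * t)\<^sup>2 + s ^ 5 + t ^ 5 = (ramanujan_phi P / A) ^ 6"
    unfolding A_def s_def t_def p5[symmetric] by (rule dissection_norm(2)[OF p])

  have lhs: "ramanujan_phi (exp (- 25 * pi * sqrt (of_rat n))) / ramanujan_phi (exp (- pi * sqrt (of_rat n))) =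
      1 / 5 * (1 + s + t)"
  proof -
    \<comment> \<open>Inversion at 25 tau and at tau leads to the nomes \<open>p\<close> and
      \<open>p ^ 25\<close>; the quotient of the two square roots is 5.\<close>
    have "gauss_theta (pi / (25 * \<tau>)) = sqrt (25 * \<tau>) * gauss_theta (pi * (25 * \<tau>))"
      using \<tau> by (intro theta_inversion) simp
    moreover have "sqrt (25 * \<tau>) = 5 * sqrt \<tau>"
      by (simp add: real_sqrt_mult)
    moreover have "gauss_theta (pi / \<tau>) = sqrt \<tau> * gauss_theta (pi * \<tau>)"
      using \<tau> by (intro theta_inversion) simp
    moreover have "gauss_theta (pi / (25 * \<tau>)) = A * (1 + s + t)"
      using phi_p by (simp add: gauss_theta_def p_def)
    moreover have "gauss_theta (pi / \<tau>) = A"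
      by (simp add: gauss_theta_def A_def p25)
    ultimately have "sqrt \<tau> * (5 * gauss_theta (pi * (25 * \<tau>))) = sqrt \<tau> * (gauss_theta (pi * \<tau>) * (1 + s + t))"
      by (simp add: mult_ac)
    moreover have "sqrt \<tau> \<noteq> 0"
      using \<tau> by simp
    ultimately have "5 * gauss_theta (pi * (25 * \<tau>)) = gauss_theta (pi * \<tau>) * (1 + s + t)"
      by (metis mult_left_cancel)
    moreover have "gauss_theta (pi * \<tau>) > 0"
      using \<tau> by (intro gauss_theta_pos) simp
    ultimately have "gauss_theta (pi * (25 * \<tau>)) / gauss_theta (pi * \<tau>) = 1 / 5 * (1 + s + t)"
      by (simp add: field_simps)
    then show ?thesis
      by (simp add: gauss_theta_def \<tau>_def mult_ac)
  qed

  have st: "s * t = 4 * (P * (jtheta (P ^ 5) (P ^ 4) * jtheta (P ^ 5) (P ^ 2))) / A\<^sup>2"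
  proof -
    have "p ^ 10 = P\<^sup>2" "p ^ 20 = P ^ 4" "p * p ^ 4 = P"
      by (simp_all add: p5[symmetric] flip: power_mult power_Suc)
    then show ?thesis
      unfolding s_def t_def P5 by (simp add: power2_eq_square[of A] mult_ac)
  qed
  have A_P: "A = ramanujan_phi (P ^ 5)"
    by (simp add: A_def P5)
  have "(ramanujan_phi P / A)\<^sup>2 = 1 + s * t"
    using phi_square_diff[OF P] A unfolding st A_P[symmetric] by (simp add: power_divide field_simps)
  then have "(ramanujan_phi P / A) ^ 6 = (1 + s * t) ^ 3"
    by (metis power_mult num_double numeral_times_numeral mult_numeral_1)
  \<comment> \<open>With v = s t the right side is (1 + v)^3 - 1 + 5 v - 5 v^2.\<close>
  with norm have sum: "s ^ 5 + t ^ 5 = 8 * (s * t) - 2 * (s * t)\<^sup>2 + (s * t) ^ 3"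
    by algebra

  have x: "2 * x = s * t"
  proof -
    have tau5: "sqrt (real_of_rat (25 * n)) = 5 * \<tau>"
      by (simp add: \<tau>_def of_rat_mult real_sqrt_mult)
    \<comment> \<open>After inversion the two invariants sit at the nomes \<open>P\<close> and
      \<open>P ^ 5\<close>, as \<open>theta_product_chi\<close> requires.\<close>
    have chi: "normalized_chi (5 * \<tau>) = normalized_chi (1 / (5 * \<tau>))" "normalized_chi \<tau> = normalized_chi (1 / \<tau>)"
      using \<tau> by (auto intro!: normalized_chi_inversion[symmetric])
    have fifth: "(2 powr (- 1 / 4)) ^ 5 = (2 powr (- 1 / 4) / 2 :: real)"
    proof -
      have "(2 powr (- 1 / 4)) ^ 5 = (2::real) powr (- 1 / 4 - 1)"
        by (simp add: powr_power)
      then show ?thesis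
        by (simp only: powr_diff) simp
    qed
    have "x = 2 * normalized_chi (5 * \<tau>) / normalized_chi \<tau> ^ 5"
      unfolding assms(2) class_invariant_eq[OF tau5[symmetric]] class_invariant_eq[OF \<tau>_def]
        power_mult_distrib fifth by simp
    also have "normalized_chi (5 * \<tau>) = exp (pi / (120 * \<tau>)) * ramanujan_chi P"
      unfolding chi by (simp add: normalized_chi_def P_def)
    also have "normalized_chi \<tau> = exp (pi / (24 * \<tau>)) * ramanujan_chi (P ^ 5)"
      unfolding chi P5 p25 by (simp add: normalized_chi_def)
    also have "2 * (exp (pi / (120 * \<tau>)) * ramanujan_chi P) / (exp (pi / (24 * \<tau>)) * ramanujan_chi (P ^ 5)) ^ 5 =
        2 * (exp (pi / (120 * \<tau>)) / exp (pi / (24 * \<tau>)) ^ 5) * (ramanujan_chi P / ramanujan_chi (P ^ 5) ^ 5)"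
      by (simp add: power_mult_distrib)
    \<comment> \<open>The prefactors combine through 1/120 - 5/24 = -1/5, which is the exponent in
      \<open>P\<close>.\<close>
    also have "exp (pi / (120 * \<tau>)) / exp (pi / (24 * \<tau>)) ^ 5 = P"
    proof -
      have "pi / (120 * \<tau>) - 5 * (pi / (24 * \<tau>)) = - pi / (5 * \<tau>)"
        using \<tau> by (simp add: field_simps)
      moreover have "exp (pi / (24 * \<tau>)) ^ 5 = exp (5 * (pi / (24 * \<tau>)))"
        by (simp flip: exp_of_nat_mult)
      ultimately show ?thesis
        unfolding P_def by (simp only: exp_diff[symmetric])
    qed
    also have "ramanujan_chi P / ramanujan_chi (P ^ 5) ^ 5 = jtheta (P ^ 5) (P ^ 4) * jtheta (P ^ 5) (P ^ 2) / A\<^sup>2"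
    proof -
      have "ramanujan_chi (P ^ 5) > 0"
        using P by (intro ramanujan_chi_pos) (auto simp: power_less_one_iff[of P 5])
      then show ?thesis
        using theta_product_chi[OF P] A unfolding A_P[symmetric] by (simp add: frac_eq_eq mult_ac)
    qed
    finally show ?thesis
      unfolding st by simp
  qed

  \<comment> \<open>The fifth powers of \<open>s\<close> and \<open>t\<close> are the roots of y^2 -
    2 c y + (2x)^5, and d^2 = c^2 - (2x)^5 is a quarter of its discriminant.\<close>
  define c where "c = x * ((2 * x - 1)\<^sup>2 + 7)"
  define d where "d = x * ((4 - 2 * x) * sqrt (4 + 4 * x\<^sup>2))"
  have sum': "s ^ 5 + t ^ 5 = 2 * c"
    unfolding sum x[symmetric] c_def by algebra
  have prod': "s ^ 5 * t ^ 5 = c\<^sup>2 - d\<^sup>2"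
  proof -
    have "d\<^sup>2 = x\<^sup>2 * ((4 - 2 * x)\<^sup>2 * (4 + 4 * x\<^sup>2))"
      by (simp add: d_def power_mult_distrib)
    moreover have "s ^ 5 * t ^ 5 = (2 * x) ^ 5"
      unfolding x by (simp add: power_mult_distrib)
    ultimately show ?thesis
      unfolding c_def by algebra
  qed
  have "(s ^ 5 - (c + d)) * (s ^ 5 - (c - d)) = 0"
    using sum' prod' by algebra
  then have "s ^ 5 = c + d \<and> t ^ 5 = c - d \<or> s ^ 5 = c - d \<and> t ^ 5 = c + d"
    using sum' by auto
  moreover have "root 5 (s ^ 5) = s" "root 5 (t ^ 5) = t"
    by (simp_all add: odd_real_root_power_cancel)
  \<comment> \<open>The odd root recovers \<open>s\<close> and \<open>t\<close> whatever their
    signs, and their sum is the same in both cases.\<close>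
  ultimately have "root 5 (c + d) + root 5 (c - d) = s + t"
    by (metis add.commute)
  moreover have "x * ((2 * x - 1)\<^sup>2 + 7 + (4 - 2 * x) * sqrt (4 + 4 * x\<^sup>2)) = c + d"
    "x * ((2 * x - 1)\<^sup>2 + 7 - (4 - 2 * x) * sqrt (4 + 4 * x\<^sup>2)) = c - d"
    by (simp_all only: c_def d_def distrib_left right_diff_distrib)
  ultimately show ?thesis
    unfolding lhs by simp
qed

end
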